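(* Let $(X,d)$ be a complete, doubling, uniformly perfect metric space, and let $c_*,C_*$ be constants with $0<c_*<C_*<\infty$. Then there exist $C_1,C_2,C_3,r_0>0$ such that the following holds. Let $r\in(0,r_0]$, and for each $k\in\mathbb{Z}$ let $\Omega_k$ be an index set (the sets $\Omega_k$ being pairwise disjoint) and $\{x_\omega\}_{\omega\in\Omega_k}\subset X$ a family of points such that for every $k\in\mathbb{Z}$: - $d(x_\omega,x_\lambda)\ge c_* r^k$ for any $\omega,\lambda\in\Omega_k$ with $\omega\neq\lambda$; - $\min_{\omega\in\Omega_k} d(y,x_\omega)<C_* r^k$ for any $y\in X$. Then there exist subsets $Q_\omega\subset X$ ($k\in\mathbb{Z}$, $\omega\in\Omega_k$) such that: (D1) $\bigcup_{\omega\in\Omega_k}Q_\omega=X$ for any $k\in\mathbb{Z}$; (D2) $\mathrm{int}\,Q_\omega=\mathrm{int}(\overline{Q_\omega})$ and $\overline{\mathrm{int}\,Q_\omega}=\overline{Q_\omega}$ for any $k\in\mathbb{Z}$, $\omega\in\Omega_k$; (D3) if $l\ge k$, then for any $\omega\in\Omega_l$ and $\lambda\in\Omega_k$, either $Q_\omega\subset Q_\lambda$ or $Q_\omega\cap Q_\lambda=\emptyset$ holds; (D4) $B(x_\omega,C_1r^k)\subset Q_\omega\subset B(x_\omega,C_2r^k)$ for any $k\in\mathbb{Z}$, $\omega\in\Omega_k$; (D5) for any $k\in\mathbb{Z}$, if $y,z\in X$ satisfy $d(y,z)\le C_3r^k$, then there exist $\omega_0,\omega_1,\omega_2\in\Omega_k$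 such that $\overline{Q_{\omega_i}}\cap\overline{Q_{\omega_{i+1}}}\neq\emptyset$ for $i=0,1$, $y\in\overline{Q_{\omega_0}}$ and $z\in\overline{Q_{\omega_2}}$.
   Context: $B(x,r)$ is the open ball of center $x$ and radius $r$; $\overline{A}$ and $\mathrm{int}\,A$ are the closure and interior of $A\subset X$. Doubling: there exists $N\in\mathbb{N}$ such that for any $x\in X$ and $r>0$ there exist $x_1,\dots,x_N\in X$ with $B(x,2r)\subset\bigcup_{i=1}^N B(x_i,r)$. Uniformly perfect: there exists $\gamma>1$ such that $B(x,\gamma r)\setminus B(x,r)\neq\emptyset$ for all $x\in X$, $r>0$ with $B(x,r)\neq X$. *)

theory Defs
  imports "HOL-Analysis.Analysis" "HOL-Library.Disjoint_Sets"
begin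

definition doubling_space :: "'a::metric_space itself \<Rightarrow> bool" where
  "doubling_space _ \<longleftrightarrow>
     (\<exists>N::nat. \<forall>(x::'a) (r::real). 0 < r \<longrightarrow>
        (\<exists>p::nat \<Rightarrow> 'a. ball x (2 * r) \<subseteq> (\<Union>i\<in>{1..N}. ball (p i) r)))"

definition uniformly_perfect_space :: "'a::metric_space itself \<Rightarrow> bool" where
  "uniformly_perfect_space _ \<longleftrightarrow>
     (\<exists>\<gamma>::real. 1 < \<gamma> \<and>
        (\<forall>(x::'a) (r::real). 0 < r \<and> ball x r \<noteq> UNIV \<longrightarrow> ball x (\<gamma> * r) - ball x r \<noteq> {}))"

text \<open>
  The covering condition says that the minimum of \<open>dist y (x \<omega>)\<close> over \<open>\<Omega> k\<close> is less than
  \<open>C * r powi k\<close>, i.e. that some value is. In particular each \<open>\<Omega> k\<close> is nonempty.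
\<close>

definition net_system ::
  "real \<Rightarrow> real \<Rightarrow> real \<Rightarrow> (int \<Rightarrow> 'i set) \<Rightarrow> ('i \<Rightarrow> 'a::metric_space) \<Rightarrow> bool" where
  "net_system c C r \<Omega> x \<longleftrightarrow>
     disjoint_family \<Omega> \<and>
     (\<forall>k. \<forall>\<omega>\<in>\<Omega> k. \<forall>\<mu>\<in>\<Omega> k. \<omega> \<noteq> \<mu> \<longrightarrow> c * r powi k \<le> dist (x \<omega>) (x \<mu>)) \<and>
     (\<forall>k. \<forall>y. \<exists>\<omega>\<in>\<Omega> k. dist y (x \<omega>) < C * r powi k)"

definition dyadic_cubes ::
  "real \<Rightarrow> real \<Rightarrow> real \<Rightarrow> real \<Rightarrow> (int \<Rightarrow> 'i set) \<Rightarrow> ('i \<Rightarrow> 'a::metric_space) \<Rightarrow>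
   ('i \<Rightarrow> 'a set) \<Rightarrow> bool" where
  "dyadic_cubes C1 C2 C3 r \<Omega> x Q \<longleftrightarrow>
     (\<forall>k. (\<Union>\<omega>\<in>\<Omega> k. Q \<omega>) = UNIV) \<and>
     (\<forall>k. \<forall>\<omega>\<in>\<Omega> k. interior (Q \<omega>) = interior (closure (Q \<omega>)) \<and>
                     closure (interior (Q \<omega>)) = closure (Q \<omega>)) \<and>
     (\<forall>k l. k \<le> l \<longrightarrow> (\<forall>\<omega>\<in>\<Omega> l. \<forall>\<mu>\<in>\<Omega> k. Q \<omega> \<subseteq> Q \<mu> \<or> Q \<omega> \<inter> Q \<mu> = {})) \<and>
     (\<forall>k. \<forall>\<omega>\<in>\<Omega> k. ball (x \<omega>) (C1 * r powi k) \<subseteq> Q \<omega> \<and> Q \<omega> \<subseteq> ball (x \<omega>) (C2 * r powi k)) \<and>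
     (\<forall>k y z. dist y z \<le> C3 * r powi k \<longrightarrow>
        (\<exists>\<omega>0\<in>\<Omega> k. \<exists>\<omega>1\<in>\<Omega> k. \<exists>\<omega>2\<in>\<Omega> k.
           closure (Q \<omega>0) \<inter> closure (Q \<omega>1) \<noteq> {} \<and> closure (Q \<omega>1) \<inter> closure (Q \<omega>2) \<noteq> {} \<and>
           y \<in> closure (Q \<omega>0) \<and> z \<in> closure (Q \<omega>2)))"

text \<open>The constants work for all families in \<open>'a\<close> whose indices are taken from the type \<open>'i\<close>.\<close>

definition dyadic_constants ::
  "'i itself \<Rightarrow> 'a::metric_space itself \<Rightarrow> real \<Rightarrow> real \<Rightarrow>
   real \<Rightarrow> real \<Rightarrow> real \<Rightarrow> real \<Rightarrow> bool" where
  "dyadic_constants _ _ c C C1 C2 C3 r0 \<longleftrightarrow>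
     (\<forall>r (\<Omega>::int \<Rightarrow> 'i set) (x::'i \<Rightarrow> 'a).
        0 < r \<and> r \<le> r0 \<and> net_system c C r \<Omega> x \<longrightarrow>
        (\<exists>Q::'i \<Rightarrow> 'a set. dyadic_cubes C1 C2 C3 r \<Omega> x Q))"

text \<open>
  The constants must be chosen before the index sets, so they must not depend on the type the
  indices come from, but HOL cannot quantify over types below an existential. To express this
  uniformity, the theorem asserts the existence of constants for the index type \<open>int \<times> 'a\<close>,
  in which \<open>'i\<close> does not occur, and that any constants which work there also work for index
  sets taken from an arbitrary type \<open>'i\<close>. (If \<open>c > 0\<close>, every net system can be reindexed
  by \<open>int \<times> 'a\<close>, via \<open>(k, x \<omega>)\<close> for \<open>\<omega> \<in> \<Omega> k\<close>.)
\<close>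

end

theory Submission
  imports Defs
begin

text \<open>
  Each index of level \<open>k + 1\<close> gets a parent of level \<open>k\<close>, normally one whose point is near. The closed
  cube of \<open>\<omega>\<close> is the closure of the points of its descendants, and \<open>Q \<omega>\<close> consists of the points
  whose chosen chain of indices \<open>(\<omega>\<^sub>k)\<close>, compatible with the parent map, passes through \<open>\<omega>\<close>; this
  makes the cubes nested partitions, and (D2) holds since the closed cubes are locally finite and
  descendants are interior.

  For (D5) closures of neighbouring cubes must intersect even if \<open>X\<close> is disconnected. If
  \<open>x\<^sub>a\<close> and \<open>x\<^sub>b\<close> are at distance at most \<open>K r\<^sup>k\<close>, uniform perfectness provides near \<open>x\<^sub>a\<close> two
  distinct points of level \<open>k + 1\<close> at distance at most \<open>K r\<^sup>k\<^sup>+\<^sup>1\<close>; one is made a child of \<open>a\<close> and the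
  other a child of \<open>b\<close>. Repeating this, \<open>a\<close> and \<open>b\<close> have descendants converging to a common point.
  By doubling only boundedly many such exceptions are needed in the ball around \<open>x\<^sub>a\<close>, so for small
  \<open>r\<close> they can be kept apart from each other and from \<open>x\<^sub>a\<close>.
\<close>

section \<open>Closed cubes of an abstract parent map\<close>

text \<open>The interface between the choice of parents and the geometry of the cubes.
  \<open>par_near\<close> puts a ball inside each cube, \<open>edge\<close> makes the closed cubes
  of indices at distance at most \<open>K * r powi k\<close> touch, and \<open>par_base\<close>
  limits the exceptions: a far parent is within \<open>K * r powi k\<close> of an index close to the
  child.\<close>

locale cube_hierarchy =
  fixes c C D K \<sigma> r :: real
    and \<Omega> :: "int \<Rightarrow> 'i set" and x :: "'i \<Rightarrow> 'a::complete_space" and par :: "'i \<Rightarrow> 'i"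
  assumes disj: "disjoint_family \<Omega>"
    and sep: "\<And>k \<omega> \<mu>. \<omega> \<in> \<Omega> k \<Longrightarrow> \<mu> \<in> \<Omega> k \<Longrightarrow> \<omega> \<noteq> \<mu> \<Longrightarrow> c * r powi k \<le> dist (x \<omega>) (x \<mu>)"
    and cover: "\<And>k y. \<exists>\<omega>\<in>\<Omega> k. dist y (x \<omega>) < C * r powi k"
    and locfin: "\<And>k y R. finite {\<omega> \<in> \<Omega> k. dist y (x \<omega>) \<le> R}"
    and r_pos: "0 < r" and r_half: "r \<le> 1/2" and sigma_pos: "0 < \<sigma>"
    and sigma_c8: "8 * \<sigma> \<le> c" and c_C: "c < C" and K_C: "2 * C + c \<le> K" and D_sigma: "4 * D * r \<le> \<sigma>" and sigma_D: "\<sigma> \<le> D"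
    and par_in: "\<And>k \<omega>. \<omega> \<in> \<Omega> (k + 1) \<Longrightarrow> par \<omega> \<in> \<Omega> k"
    and par_dist: "\<And>k \<omega>. \<omega> \<in> \<Omega> (k + 1) \<Longrightarrow> dist (x \<omega>) (x (par \<omega>)) \<le> D * r powi k"
    and par_near: "\<And>k \<omega> \<mu>. \<omega> \<in> \<Omega> (k + 1) \<Longrightarrow> \<mu> \<in> \<Omega> k \<Longrightarrow>
                     dist (x \<omega>) (x \<mu>) < \<sigma> * r powi k \<Longrightarrow> par \<omega> = \<mu>"
    and edge: "\<And>k \<omega> \<mu>. \<omega> \<in> \<Omega> k \<Longrightarrow> \<mu> \<in> \<Omega> k \<Longrightarrow> dist (x \<omega>) (x \<mu>) \<le> K * r powi k \<Longrightarrow>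
                 \<exists>\<omega>'\<in>\<Omega> (k + 1). \<exists>\<mu>'\<in>\<Omega> (k + 1).
                   par \<omega>' = \<omega> \<and> par \<mu>' = \<mu> \<and> dist (x \<omega>') (x \<mu>') \<le> K * r powi (k + 1)"
    and par_base: "\<And>k \<omega>. \<omega> \<in> \<Omega> (k + 1) \<Longrightarrow> dist (x \<omega>) (x (par \<omega>)) < C * r powi k \<or>
                     (\<exists>\<mu>\<in>\<Omega> k. dist (x \<omega>) (x \<mu>) < c / 4 * r powi k \<and>
                              dist (x \<mu>) (x (par \<omega>)) \<le> K * r powi k)"
begin

lemma powi_pos [simp]: "0 < r powi k"
  using r_pos by simp

lemma powi_nonneg [simp]: "0 \<le> r powi k"
  by (rule less_imp_le) simp

lemma powi_Suc: "r powi (k + 1) = r * r powi k" "r powi (1 + k) = r * r powi k"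
  using r_pos by (simp_all add: power_int_add)

lemma powi_add_nat: "r powi (k + int n) = r powi k * r ^ n"
  using r_pos by (simp add: power_int_add)

lemma sigma_c: "\<sigma> \<le> c" and C_pos: "0 < C" and K_pos: "0 < K"
  using sigma_pos sigma_c8 c_C K_C by linarith+

lemma D_pos: "0 < D"
  using sigma_pos sigma_D by simp

text \<open>By \<open>ancestor\<close>, all descendants of an index of level \<open>k + 1\<close>
  lie within \<open>2 * D * r powi (k + 1)\<close> of its point. The factor 4 makes this at most
  half of the radius within which \<open>par_near\<close> fixes the parent.\<close>

lemma D_scale: "4 * (D * r powi (k + 1)) \<le> \<sigma> * r powi k"
proof -
  have "4 * D * r * r powi k \<le> \<sigma> * r powi k"
    using D_sigma by (intro mult_right_mono) auto
  then show ?thesis by (simp add: powi_Suc)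
qed

text \<open>The steps to successive parents are bounded by a geometric series of ratio at most
  \<open>1/2\<close>, which sums to at most twice its largest term.\<close>

lemma ancestor:
  assumes "\<omega> \<in> \<Omega> (k + int n)"
  shows "(par ^^ n) \<omega> \<in> \<Omega> k \<and> dist (x \<omega>) (x ((par ^^ n) \<omega>)) \<le> 2 * D * r powi k"
  using assms
proof (induction n arbitrary: k)
  case 0
  then show ?case using D_pos by simp
next
  case (Suc n)
  have "\<omega> \<in> \<Omega> (k + 1 + int n)" using Suc.prems by (simp add: algebra_simps)
  from Suc.IH[OF this] have w: "(par ^^ n) \<omega> \<in> \<Omega> (k + 1)"
    and d: "dist (x \<omega>) (x ((par ^^ n) \<omega>)) \<le> 2 * D * r powi (k + 1)" by auto
  have "2 * D * r powi (k + 1) \<le> D * r powi k"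
  proof -
    have "2 * r * (D * r powi k) \<le> 1 * (D * r powi k)"
      using r_half D_pos powi_pos[of k] by (intro mult_right_mono) auto
    then show ?thesis by (simp add: powi_Suc algebra_simps)
  qed
  with d par_dist[OF w] dist_triangle[of "x \<omega>" "x (par ((par ^^ n) \<omega>))" "x ((par ^^ n) \<omega>)"]
  have "dist (x \<omega>) (x (par ((par ^^ n) \<omega>))) \<le> 2 * D * r powi k"
    by linarith
  then show ?case using par_in[OF w] by simp
qed

definition descendants :: "int \<Rightarrow> 'i \<Rightarrow> 'i set" where
  "descendants k \<omega> = {\<kappa>. \<exists>n. \<kappa> \<in> \<Omega> (k + int n) \<and> (par ^^ n) \<kappa> = \<omega>}"

definition closed_cube :: "int \<Rightarrow> 'i \<Rightarrow> 'a set" where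
  "closed_cube k \<omega> = closure (x ` descendants k \<omega>)"

lemma closed_closed_cube [simp]: "closed (closed_cube k \<omega>)"
  by (simp add: closed_cube_def)

lemma descendant_in_closed_cube: "\<mu> \<in> descendants k \<omega> \<Longrightarrow> x \<mu> \<in> closed_cube k \<omega>"
  unfolding closed_cube_def by (intro subsetD[OF closure_subset] imageI)

lemma descendants_par: "descendants (k + int n) \<omega> \<subseteq> descendants k ((par ^^ n) \<omega>)"
proof
  fix \<kappa> assume "\<kappa> \<in> descendants (k + int n) \<omega>"
  then obtain m where "\<kappa> \<in> \<Omega> (k + int n + int m)" "(par ^^ m) \<kappa> = \<omega>"
    by (auto simp: descendants_def)
  then have "\<kappa> \<in> \<Omega> (k + int (n + m))" "(par ^^ (n + m)) \<kappa> = (par ^^ n) \<omega>"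
    by (simp_all add: add.assoc funpow_add)
  then show "\<kappa> \<in> descendants k ((par ^^ n) \<omega>)"
    unfolding descendants_def by blast
qed

lemma closed_cube_par:
  "closed_cube (k + int n) \<omega> \<subseteq> closed_cube k ((par ^^ n) \<omega>)"
  unfolding closed_cube_def by (intro closure_mono image_mono descendants_par)

lemma closed_cube_subset_cball: "closed_cube k \<omega> \<subseteq> cball (x \<omega>) (2 * D * r powi k)"
proof -
  have "x ` descendants k \<omega> \<subseteq> cball (x \<omega>) (2 * D * r powi k)"
    using ancestor by (fastforce simp: descendants_def dist_commute)
  then show ?thesis unfolding closed_cube_def by (simp add: closure_minimal)
qed

lemma closed_cube_dist: "y \<in> closed_cube k \<omega> \<Longrightarrow> dist y (x \<omega>) \<le> 2 * D * r powi k"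
  using closed_cube_subset_cball by (fastforce simp: dist_commute)

lemma scale_tendsto_0: "(\<lambda>n. B * r powi (k + int n)) \<longlonglongrightarrow> 0"
proof -
  have "(\<lambda>n. B * r powi k * r ^ n) \<longlonglongrightarrow> 0"
    using r_pos r_half by (intro tendsto_mult_right_zero LIMSEQ_realpow_zero) auto
  then show ?thesis by (simp add: powi_add_nat mult.assoc)
qed

text \<open>Net points of ever finer levels come arbitrarily close to \<open>y\<close>. Their
  ancestors of level \<open>k\<close> all lie in the finite set \<open>F\<close>, so the union of
  the closed cubes over \<open>F\<close> is closed and contains \<open>y\<close>.\<close>

lemma closed_cubes_cover: "\<exists>\<omega>\<in>\<Omega> k. y \<in> closed_cube k \<omega>"
proof -
  define F where "F = {\<omega> \<in> \<Omega> k. dist y (x \<omega>) \<le> (C + 2 * D) * r powi k}"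
  have "closed (\<Union>\<omega>\<in>F. closed_cube k \<omega>)"
    unfolding F_def by (intro closed_UN locfin) auto
  moreover have "y \<in> closure (\<Union>\<omega>\<in>F. closed_cube k \<omega>)"
    unfolding closure_approachable
  proof (intro allI impI)
    fix e :: real assume "0 < e"
    have "\<forall>\<^sub>F n in sequentially. C * r powi (k + int n) < e"
      using scale_tendsto_0[of C k] \<open>0 < e\<close> by (rule order_tendstoD(2))
    then obtain n where n: "C * r powi (k + int n) < e"
      by (auto simp: eventually_sequentially)
    obtain \<omega> where w: "\<omega> \<in> \<Omega> (k + int n)" "dist y (x \<omega>) < C * r powi (k + int n)"
      using cover by blast
    have "r powi k * r ^ n \<le> r powi k * 1"
      using r_pos r_half by (intro mult_left_mono power_le_one) auto
    then have "C * r powi (k + int n) \<le> C * r powi k"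
      using C_pos by (simp add: powi_add_nat)
    with w ancestor[OF w(1)] dist_triangle[of y "x ((par ^^ n) \<omega>)" "x \<omega>"]
    have "(par ^^ n) \<omega> \<in> F" unfolding F_def by (auto simp: algebra_simps)
    moreover have "x \<omega> \<in> closed_cube k ((par ^^ n) \<omega>)"
      using w by (intro descendant_in_closed_cube) (auto simp: descendants_def)
    ultimately show "\<exists>z\<in>\<Union>\<omega>\<in>F. closed_cube k \<omega>. dist z y < e"
      using w n by (intro bexI[of _ "x \<omega>"]) (auto simp: dist_commute)
  qed
  ultimately have "y \<in> (\<Union>\<omega>\<in>F. closed_cube k \<omega>)" by simp
  then show ?thesis by (auto simp: F_def)
qed

text \<open>This lets a chain of cubes through \<open>y\<close> be continued to finer levels. Points
  of descendants approach \<open>y\<close>, each lies in the closed cube of some child, and those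
  within distance 1 of \<open>y\<close> belong to the finitely many children in
  \<open>F\<close>.\<close>

lemma closed_cube_child:
  assumes "\<omega> \<in> \<Omega> k" "y \<in> closed_cube k \<omega>"
  shows "\<exists>\<mu>\<in>\<Omega> (k + 1). par \<mu> = \<omega> \<and> y \<in> closed_cube (k + 1) \<mu>"
proof -
  define R where "R = 2 * D * r powi (k + 1)"
  define F where "F = {\<mu> \<in> \<Omega> (k + 1). par \<mu> = \<omega> \<and> dist y (x \<mu>) \<le> 1 + R}"
  have "finite F"
    by (rule finite_subset[OF _ locfin[of "k + 1" y "1 + R"]]) (auto simp: F_def)
  then have "closed (\<Union>\<mu>\<in>F. closed_cube (k + 1) \<mu>)"
    by (intro closed_UN) auto
  moreover have "y \<in> closure (\<Union>\<mu>\<in>F. closed_cube (k + 1) \<mu>)"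
    unfolding closure_approachable
  proof (intro allI impI)
    fix e :: real assume "0 < e"
    obtain \<kappa> where l: "\<kappa> \<in> descendants k \<omega>" "dist (x \<kappa>) y < min e 1"
      using assms(2) \<open>0 < e\<close> unfolding closed_cube_def closure_approachable
      by (metis image_iff min_less_iff_conj zero_less_one)
    have "\<exists>\<mu>\<in>\<Omega> (k + 1). par \<mu> = \<omega> \<and> x \<kappa> \<in> closed_cube (k + 1) \<mu>"
    proof -
      obtain n where n: "\<kappa> \<in> \<Omega> (k + int n)" "(par ^^ n) \<kappa> = \<omega>"
        using l by (auto simp: descendants_def)
      show ?thesis
      proof (cases n)
        \<comment> \<open>Here \<open>\<kappa>\<close> is \<open>\<omega>\<close> itself, whose
          point need not be a net point of level \<open>k + 1\<close>. Some closed cube of level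
          \<open>k + 1\<close> contains it, and \<open>par_near\<close> forces the index of that
          cube to be a child of \<open>\<omega>\<close>.\<close>
        case 0
        obtain \<mu> where m: "\<mu> \<in> \<Omega> (k + 1)" "x \<omega> \<in> closed_cube (k + 1) \<mu>"
          using closed_cubes_cover by blast
        have "0 < D * r powi (k + 1)" using D_pos by simp
        then have "dist (x \<mu>) (x \<omega>) < \<sigma> * r powi k"
          using closed_cube_dist[OF m(2)] D_scale[of k] by (subst dist_commute) linarith
        then have "par \<mu> = \<omega>" using par_near m(1) assms(1) by blast
        then show ?thesis using m 0 n by auto
      next
        case (Suc m)
        have l1: "\<kappa> \<in> \<Omega> (k + 1 + int m)" using n Suc by (simp add: algebra_simps)
        then have "x \<kappa> \<in> closed_cube (k + 1) ((par ^^ m) \<kappa>)"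
          by (intro descendant_in_closed_cube) (auto simp: descendants_def)
        moreover have "(par ^^ m) \<kappa> \<in> \<Omega> (k + 1)" using ancestor[OF l1] by simp
        ultimately show ?thesis using n Suc by (intro bexI[of _ "(par ^^ m) \<kappa>"]) auto
      qed
    qed
    then obtain \<mu> where m: "\<mu> \<in> \<Omega> (k + 1)" "par \<mu> = \<omega>" "x \<kappa> \<in> closed_cube (k + 1) \<mu>" by blast
    have "dist y (x \<mu>) \<le> 1 + R"
      using closed_cube_dist[OF m(3)] l(2) dist_triangle[of y "x \<mu>" "x \<kappa>"]
      by (simp add: R_def dist_commute)
    with m have "\<mu> \<in> F" by (simp add: F_def)
    with m l show "\<exists>z\<in>\<Union>\<mu>\<in>F. closed_cube (k + 1) \<mu>. dist z y < e"
      by (intro bexI[of _ "x \<kappa>"]) auto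
  qed
  ultimately have "y \<in> (\<Union>\<mu>\<in>F. closed_cube (k + 1) \<mu>)" by simp
  then show ?thesis by (auto simp: F_def)
qed

lemma closed_cube_descendant:
  assumes "\<omega> \<in> \<Omega> k" "y \<in> closed_cube k \<omega>"
  shows "\<exists>\<mu>\<in>\<Omega> (k + int n). (par ^^ n) \<mu> = \<omega> \<and> y \<in> closed_cube (k + int n) \<mu>"
proof (induction n)
  case 0
  then show ?case using assms by simp
next
  case (Suc n)
  then obtain \<mu> where m: "\<mu> \<in> \<Omega> (k + int n)" "(par ^^ n) \<mu> = \<omega>" "y \<in> closed_cube (k + int n) \<mu>"
    by blast
  obtain \<nu> where v: "\<nu> \<in> \<Omega> (k + int n + 1)" "par \<nu> = \<mu>" "y \<in> closed_cube (k + int n + 1) \<nu>"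
    using closed_cube_child[OF m(1,3)] by blast
  have "k + int (Suc n) = k + int n + 1" by simp
  moreover have "(par ^^ Suc n) \<nu> = \<omega>"
    using m(2) v(2) by (simp only: funpow_Suc_right o_apply)
  ultimately show ?case using v(1,3) by metis
qed

section \<open>Inner balls, open cubes and (D2)\<close>

text \<open>If a proper descendant of \<open>\<mu>\<close> came this close to
  \<open>x \<omega>\<close>, its ancestor of level \<open>k + 1\<close> would be within
  \<open>\<sigma> * r powi k\<close> of \<open>x \<omega>\<close> by \<open>D_scale\<close>, and
  \<open>par_near\<close> would make \<open>\<omega>\<close> the parent instead of
  \<open>\<mu>\<close>. An open ball that misses a set also misses its closure.\<close>

lemma inner_ball_disjoint:
  assumes "\<omega> \<in> \<Omega> k" "\<mu> \<in> \<Omega> k" "\<omega> \<noteq> \<mu>"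
  shows "ball (x \<omega>) (\<sigma> / 2 * r powi k) \<inter> closed_cube k \<mu> = {}"
proof -
  have "x \<kappa> \<notin> ball (x \<omega>) (\<sigma> / 2 * r powi k)" if l: "\<kappa> \<in> descendants k \<mu>" for \<kappa>
  proof
    assume "x \<kappa> \<in> ball (x \<omega>) (\<sigma> / 2 * r powi k)"
    then have d: "dist (x \<kappa>) (x \<omega>) < \<sigma> / 2 * r powi k" by (simp add: dist_commute)
    obtain n where n: "\<kappa> \<in> \<Omega> (k + int n)" "(par ^^ n) \<kappa> = \<mu>"
      using l by (auto simp: descendants_def)
    show False
    proof (cases n)
      case 0
      have "\<sigma> * r powi k \<le> c * r powi k"
        using sigma_c by (intro mult_right_mono) auto
      moreover have "0 < \<sigma> * r powi k" using sigma_pos by simp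
      moreover have "\<kappa> = \<mu>" using n 0 by simp
      ultimately show False using sep[OF assms] d by (simp only: dist_commute)
    next
      case (Suc m)
      have l1: "\<kappa> \<in> \<Omega> (k + 1 + int m)" using n Suc by (simp add: algebra_simps)
      define w where "w = (par ^^ m) \<kappa>"
      have w: "w \<in> \<Omega> (k + 1)" "dist (x \<kappa>) (x w) \<le> 2 * D * r powi (k + 1)"
        using ancestor[OF l1] by (auto simp: w_def)
      have "dist (x w) (x \<omega>) < \<sigma> * r powi k"
        using w(2) d dist_triangle3[of "x w" "x \<omega>" "x \<kappa>"] D_scale[of k] by linarith
      then have "par w = \<omega>" using par_near w(1) assms(1) by blast
      then show False using n Suc assms(3) by (simp add: w_def)
    qed
  qed
  then have "ball (x \<omega>) (\<sigma> / 2 * r powi k) \<inter> x ` descendants k \<mu> = {}" by blast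
  then show ?thesis unfolding closed_cube_def by (simp add: open_Int_closure_eq_empty)
qed

text \<open>This turns out to be the interior of the closed cube, see
  \<open>interior_closed_cube\<close>. Written as a complement, it is open by local finiteness and
  is disjoint from the other closed cubes of its level.\<close>

definition open_cube :: "int \<Rightarrow> 'i \<Rightarrow> 'a set" where
  "open_cube k \<omega> = - (\<Union>\<mu>\<in>\<Omega> k - {\<omega>}. closed_cube k \<mu>)"

text \<open>A closed cube of level \<open>k\<close> that meets \<open>ball y 1\<close> has its point
  within \<open>1 + 2 * D * r powi k\<close> of \<open>y\<close>, so near \<open>y\<close> only a
  finite union of closed sets is removed.\<close>

lemma open_open_cube: "open (open_cube k \<omega>)"
  unfolding open_contains_ball
proof
  fix y assume y: "y \<in> open_cube k \<omega>"
  define F where "F = {\<mu> \<in> \<Omega> k. dist y (x \<mu>) \<le> 1 + 2 * D * r powi k} - {\<omega>}"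
  have "closed (\<Union>\<mu>\<in>F. closed_cube k \<mu>)"
    unfolding F_def by (intro closed_UN finite_Diff locfin) auto
  then have "open (ball y 1 - (\<Union>\<mu>\<in>F. closed_cube k \<mu>))" by (intro open_Diff) auto
  moreover have "y \<in> ball y 1 - (\<Union>\<mu>\<in>F. closed_cube k \<mu>)"
    using y by (auto simp: F_def open_cube_def)
  ultimately obtain e where "0 < e" and e: "ball y e \<subseteq> ball y 1 - (\<Union>\<mu>\<in>F. closed_cube k \<mu>)"
    by (meson open_contains_ball)
  have "z \<in> open_cube k \<omega>" if "z \<in> ball y e" for z
    unfolding open_cube_def
  proof (intro ComplI, elim UN_E)
    fix \<mu> assume "\<mu> \<in> \<Omega> k - {\<omega>}" "z \<in> closed_cube k \<mu>"
    then have m: "\<mu> \<in> \<Omega> k" "\<mu> \<noteq> \<omega>" "z \<in> closed_cube k \<mu>" by auto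
    have "dist y z < 1" "z \<notin> (\<Union>\<mu>\<in>F. closed_cube k \<mu>)" using that e by auto
    moreover from this(1) have "\<mu> \<in> F"
      using m closed_cube_dist[OF m(3)] dist_triangle[of y "x \<mu>" z] by (simp add: F_def)
    ultimately show "False" using m by blast
  qed
  with \<open>0 < e\<close> show "\<exists>e>0. ball y e \<subseteq> open_cube k \<omega>" by blast
qed

lemma inner_ball_open_cube:
  "\<omega> \<in> \<Omega> k \<Longrightarrow> ball (x \<omega>) (\<sigma> / 2 * r powi k) \<subseteq> open_cube k \<omega>"
  using inner_ball_disjoint unfolding open_cube_def by blast

text \<open>If \<open>x \<kappa>\<close> lay in the closed cube of another \<open>\<mu>\<close>, it
  would lie in the closed cube of a descendant \<open>\<nu>\<close> of \<open>\<mu>\<close> of the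
  same level as \<open>\<kappa>\<close>. Then \<open>\<nu>\<close> differs from
  \<open>\<kappa>\<close>, but \<open>x \<kappa>\<close> is the center of an inner ball that misses
  the closed cube of \<open>\<nu>\<close>.\<close>

lemma descendant_in_open_cube:
  assumes "\<omega> \<in> \<Omega> k" "\<kappa> \<in> descendants k \<omega>"
  shows "x \<kappa> \<in> open_cube k \<omega>"
  unfolding open_cube_def
proof (intro ComplI, elim UN_E)
  fix \<mu> assume "\<mu> \<in> \<Omega> k - {\<omega>}" "x \<kappa> \<in> closed_cube k \<mu>"
  then have m: "\<mu> \<in> \<Omega> k" "\<mu> \<noteq> \<omega>" "x \<kappa> \<in> closed_cube k \<mu>" by auto
  obtain n where n: "\<kappa> \<in> \<Omega> (k + int n)" "(par ^^ n) \<kappa> = \<omega>"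
    using assms by (auto simp: descendants_def)
  obtain \<nu> where v: "\<nu> \<in> \<Omega> (k + int n)" "(par ^^ n) \<nu> = \<mu>" "x \<kappa> \<in> closed_cube (k + int n) \<nu>"
    using closed_cube_descendant[OF m(1,3)] by blast
  have "x \<kappa> \<in> ball (x \<kappa>) (\<sigma> / 2 * r powi (k + int n))" using sigma_pos by simp
  then show False using inner_ball_disjoint[OF n(1) v(1)] v n m by blast
qed

lemma closure_open_cube: 
  assumes "\<omega> \<in> \<Omega> k" shows "closure (open_cube k \<omega>) = closed_cube k \<omega>"
proof
  have "open_cube k \<omega> \<subseteq> closed_cube k \<omega>"
    using closed_cubes_cover[of k] unfolding open_cube_def by blast
  then show "closure (open_cube k \<omega>) \<subseteq> closed_cube k \<omega>" by (simp add: closure_minimal)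
  show "closed_cube k \<omega> \<subseteq> closure (open_cube k \<omega>)"
    unfolding closed_cube_def using descendant_in_open_cube[OF assms] by (intro closure_mono) auto
qed

text \<open>For another index \<open>\<mu>\<close>, the open cube is dense in the closed one. Hence
  an interior point of \<open>closed_cube k \<omega>\<close> lying in
  \<open>closed_cube k \<mu>\<close> would yield a point of \<open>open_cube k \<mu>\<close> inside
  \<open>closed_cube k \<omega>\<close>, which is impossible.\<close>

lemma interior_closed_cube:
  assumes "\<omega> \<in> \<Omega> k" shows "interior (closed_cube k \<omega>) = open_cube k \<omega>"
proof
  show "open_cube k \<omega> \<subseteq> interior (closed_cube k \<omega>)"
    using closure_open_cube[OF assms] open_open_cube closure_subset by (metis interior_maximal)
  show "interior (closed_cube k \<omega>) \<subseteq> open_cube k \<omega>"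
    unfolding open_cube_def
  proof (intro subsetI ComplI, elim UN_E)
    fix y \<mu> assume "y \<in> interior (closed_cube k \<omega>)" "\<mu> \<in> \<Omega> k - {\<omega>}" "y \<in> closed_cube k \<mu>"
    then have y: "y \<in> interior (closed_cube k \<omega>)" "\<mu> \<in> \<Omega> k" "\<mu> \<noteq> \<omega>" "y \<in> closed_cube k \<mu>" by auto
    then have "y \<in> closure (open_cube k \<mu>)" by (simp add: closure_open_cube)
    then have "interior (closed_cube k \<omega>) \<inter> open_cube k \<mu> \<noteq> {}"
      using y(1) open_Int_closure_eq_empty[OF open_interior] by blast
    then show False using interior_subset assms y unfolding open_cube_def by blast
  qed
qed

text \<open>(D2) thus holds for any choice of cubes between the open and the closed ones.\<close>

lemma between_open_closed_cube:
  assumes "\<omega> \<in> \<Omega> k" "open_cube k \<omega> \<subseteq> Q" "Q \<subseteq> closed_cube k \<omega>"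
  shows "closure Q = closed_cube k \<omega>" "interior Q = open_cube k \<omega>"
proof -
  have "closed_cube k \<omega> \<subseteq> closure Q"
    using closure_mono[OF assms(2)] closure_open_cube[OF assms(1)] by simp
  moreover have "closure Q \<subseteq> closed_cube k \<omega>"
    using assms(3) by (simp add: closure_minimal)
  ultimately show "closure Q = closed_cube k \<omega>" by simp
  have "interior Q \<subseteq> open_cube k \<omega>"
    using interior_mono[OF assms(3)] interior_closed_cube[OF assms(1)] by simp
  moreover have "open_cube k \<omega> \<subseteq> interior Q"
    using assms(2) open_open_cube by (rule interior_maximal)
  ultimately show "interior Q = open_cube k \<omega>" by simp
qed

section \<open>Chains through a point, touching cubes and (D5)\<close>

text \<open>Starting from a closed cube of level 0 that contains \<open>y\<close>, the positive
  levels are filled by choosing children with \<open>closed_cube_child\<close>, the negative ones by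
  iterating \<open>par\<close>.\<close>

lemma exists_chain:
  "\<exists>h. \<forall>k. h k \<in> \<Omega> k \<and> y \<in> closed_cube k (h k) \<and> par (h (k + 1)) = h k"
proof -
  obtain \<omega> where w: "\<omega> \<in> \<Omega> 0" "y \<in> closed_cube 0 \<omega>" using closed_cubes_cover by blast
  \<comment> \<open>The clause for \<open>n = 0\<close> pins the start of the sequence to
    \<open>\<omega>\<close>, so that the two halves of the chain fit together.\<close>
  have "\<exists>g. \<forall>n. (g n \<in> \<Omega> (int n) \<and> y \<in> closed_cube (int n) (g n) \<and> (n = 0 \<longrightarrow> g n = \<omega>)) \<and> par (g (Suc n)) = g n"
  proof (rule dependent_nat_choice)
    show "\<exists>v. v \<in> \<Omega> (int 0) \<and> y \<in> closed_cube (int 0) v \<and> (0 = (0::nat) \<longrightarrow> v = \<omega>)" using w by simp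
    fix v n assume "v \<in> \<Omega> (int n) \<and> y \<in> closed_cube (int n) v \<and> (n = 0 \<longrightarrow> v = \<omega>)"
    then show "\<exists>u. (u \<in> \<Omega> (int (Suc n)) \<and> y \<in> closed_cube (int (Suc n)) u \<and> (Suc n = 0 \<longrightarrow> u = \<omega>)) \<and> par u = v"
      using closed_cube_child[of v "int n" y] by (simp add: add.commute) blast
  qed
  then obtain g where g: "\<And>n. g n \<in> \<Omega> (int n)" "\<And>n. y \<in> closed_cube (int n) (g n)" "g 0 = \<omega>"
    "\<And>n. par (g (Suc n)) = g n" by blast
  define h where "h k = (if 0 \<le> k then g (nat k) else (par ^^ nat (- k)) \<omega>)" for k
  have "h k \<in> \<Omega> k \<and> y \<in> closed_cube k (h k) \<and> par (h (k + 1)) = h k" for k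
  proof (cases "0 \<le> k")
    case True
    then show ?thesis using g(1,2)[of "nat k"] g(4)[of "nat k"] by (simp add: h_def nat_add_distrib)
  next
    case False
    define n where "n = nat (- k)"
    have n: "k + int n = 0" using False by (simp add: n_def)
    have "h k = (par ^^ n) \<omega>" using False by (simp add: h_def n_def)
    moreover have "par (h (k + 1)) = (par ^^ n) \<omega>"
    \<comment> \<open>For \<open>k = -1\<close> the next level is 0, where \<open>h\<close> is given
      by \<open>g\<close> and not by iterated parents.\<close>
    proof (cases "k = -1")
      case True
      then show ?thesis by (simp add: h_def n_def g)
    next
      case F: False
      then have "nat (- k) = Suc (nat (- (k + 1)))" using False by simp
      then show ?thesis using False F by (simp add: h_def n_def)
    qed
    ultimately show ?thesis using ancestor[of \<omega> k n] closed_cube_par[of k n \<omega>] w n by auto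
  qed
  then show ?thesis by blast
qed

text \<open>Iterating \<open>edge\<close> yields descendants of \<open>\<omega>\<close> and
  \<open>\<mu>\<close> of each level \<open>k + int n\<close> at distance at most
  \<open>K * r powi (k + int n)\<close>. By \<open>ancestor\<close> the first sequence is Cauchy; by
  completeness it has a limit, which the second sequence shares and which lies in both closed
  cubes.\<close>

lemma closed_cubes_meet:
  assumes "\<omega> \<in> \<Omega> k" "\<mu> \<in> \<Omega> k" "dist (x \<omega>) (x \<mu>) \<le> K * r powi k"
  shows "closed_cube k \<omega> \<inter> closed_cube k \<mu> \<noteq> {}"
proof -
  have "\<exists>f. \<forall>n. (fst (f n) \<in> \<Omega> (k + int n) \<and> snd (f n) \<in> \<Omega> (k + int n) \<and>
              dist (x (fst (f n))) (x (snd (f n))) \<le> K * r powi (k + int n) \<and> (n = 0 \<longrightarrow> f n = (\<omega>, \<mu>))) \<and>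
            (par (fst (f (Suc n))) = fst (f n) \<and> par (snd (f (Suc n))) = snd (f n))"
  proof (rule dependent_nat_choice)
    fix p n assume "fst p \<in> \<Omega> (k + int n) \<and> snd p \<in> \<Omega> (k + int n) \<and>
      dist (x (fst p)) (x (snd p)) \<le> K * r powi (k + int n) \<and> (n = 0 \<longrightarrow> p = (\<omega>, \<mu>))"
    then obtain a b where "a \<in> \<Omega> (k + int n + 1)" "b \<in> \<Omega> (k + int n + 1)" "par a = fst p" "par b = snd p"
      "dist (x a) (x b) \<le> K * r powi (k + int n + 1)" using edge by blast
    then show "\<exists>q. (fst q \<in> \<Omega> (k + int (Suc n)) \<and> snd q \<in> \<Omega> (k + int (Suc n)) \<and>
        dist (x (fst q)) (x (snd q)) \<le> K * r powi (k + int (Suc n)) \<and> (Suc n = 0 \<longrightarrow> q = (\<omega>, \<mu>))) \<and>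
        par (fst q) = fst p \<and> par (snd q) = snd p"
      by (intro exI[of _ "(a, b)"]) (simp add: algebra_simps)
  qed (use assms in auto)
  then obtain f where f: "\<And>n. fst (f n) \<in> \<Omega> (k + int n)" "\<And>n. snd (f n) \<in> \<Omega> (k + int n)"
     "\<And>n. dist (x (fst (f n))) (x (snd (f n))) \<le> K * r powi (k + int n)" "f 0 = (\<omega>, \<mu>)"
     "\<And>n. par (fst (f (Suc n))) = fst (f n)" "\<And>n. par (snd (f (Suc n))) = snd (f n)"
    by blast
  have anc: "(par ^^ m) (g (n + m)) = g n" if "\<And>n. par (g (Suc n)) = g n" for g n m
  proof (induction m)
    case (Suc m)
    have "(par ^^ Suc m) (g (n + Suc m)) = (par ^^ m) (par (g (Suc (n + m))))"
      by (simp only: funpow_Suc_right o_apply add_Suc_right)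
    then show ?case using Suc by (simp only: that)
  qed simp
  have desc: "x (g n) \<in> closed_cube k (g 0)" 
    if "\<And>n. par (g (Suc n)) = g n" "\<And>n. g n \<in> \<Omega> (k + int n)" for g n
    using that(2)[of n] anc[of g n 0] that(1)
    by (intro descendant_in_closed_cube) (auto simp: descendants_def intro!: exI[of _ n])
  define a where "a n = x (fst (f n))" for n
  define b where "b n = x (snd (f n))" for n
  have "Cauchy a"
    unfolding Cauchy_altdef2
  proof (intro allI impI)
    fix e :: real assume "0 < e"
    have "\<forall>\<^sub>F n in sequentially. 2 * D * r powi (k + int n) < e"
      using scale_tendsto_0[of "2 * D" k] \<open>0 < e\<close> by (rule order_tendstoD(2))
    then obtain N where N: "2 * D * r powi (k + int N) < e"
      by (auto simp: eventually_sequentially)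
    have "dist (a n) (a N) < e" if "N \<le> n" for n
    proof -
      have "fst (f n) \<in> \<Omega> (k + int N + int (n - N))" using f(1)[of n] that by simp
      from ancestor[OF this] have "dist (a n) (x ((par ^^ (n - N)) (fst (f n)))) \<le> 2 * D * r powi (k + int N)"
        by (simp add: a_def)
      moreover have "(par ^^ (n - N)) (fst (f n)) = fst (f N)"
        using anc[of "\<lambda>n. fst (f n)" "n - N" N] f(5) that by simp
      ultimately show ?thesis using N by (simp add: a_def)
    qed
    then show "\<exists>N. \<forall>n\<ge>N. dist (a n) (a N) < e" by blast
  qed
  then obtain l where l: "a \<longlonglongrightarrow> l" using Cauchy_convergent convergent_def by blast
  have ab: "(\<lambda>n. dist (a n) (b n)) \<longlonglongrightarrow> 0"
    by (rule tendsto_sandwich[OF _ _ tendsto_const scale_tendsto_0[of K k]])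
       (auto simp: a_def b_def f(3))
  have "b \<longlonglongrightarrow> l"
    unfolding tendsto_dist_iff[of b]
  proof (rule tendsto_sandwich[OF _ _ tendsto_const])
    show "(\<lambda>n. dist (a n) (b n) + dist (a n) l) \<longlonglongrightarrow> 0"
      using ab l unfolding tendsto_dist_iff[of a] by (rule tendsto_add_zero)
    show "\<forall>\<^sub>F n in sequentially. dist (b n) l \<le> dist (a n) (b n) + dist (a n) l"
      by (simp add: dist_triangle3)
  qed simp
  moreover have "a n \<in> closed_cube k \<omega>" "b n \<in> closed_cube k \<mu>" for n
    unfolding a_def b_def
    using desc[of "\<lambda>n. fst (f n)"] desc[of "\<lambda>n. snd (f n)"] f by auto
  ultimately have "l \<in> closed_cube k \<omega>" "l \<in> closed_cube k \<mu>"
    using l by (auto intro: closed_sequentially[OF closed_closed_cube])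
  then show ?thesis by blast
qed

text \<open>
  Three cubes suffice: if a parent is far, its child lies within \<open>c / 4 * r powi k\<close> of some \<open>x \<mu>\<close>, and
  the cube of \<open>\<mu>\<close> serves as the middle one. If both parents are far, the two \<open>\<mu>\<close> coincide
  by separation.
\<close>

lemma close_points_linked:
  assumes "dist y z \<le> c / 8 * r powi k"
  shows "\<exists>\<omega>0\<in>\<Omega> k. \<exists>\<omega>1\<in>\<Omega> k. \<exists>\<omega>2\<in>\<Omega> k.
           closed_cube k \<omega>0 \<inter> closed_cube k \<omega>1 \<noteq> {} \<and> closed_cube k \<omega>1 \<inter> closed_cube k \<omega>2 \<noteq> {} \<and>
           y \<in> closed_cube k \<omega>0 \<and> z \<in> closed_cube k \<omega>2"
proof -
  let ?R = "r powi k"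
  have R: "0 < ?R" by simp
  obtain v w where v: "v \<in> \<Omega> (k + 1)" "y \<in> closed_cube (k + 1) v"
    and w: "w \<in> \<Omega> (k + 1)" "z \<in> closed_cube (k + 1) w"
    using closed_cubes_cover by meson
  have pv: "par v \<in> \<Omega> k" "y \<in> closed_cube k (par v)" and pw: "par w \<in> \<Omega> k" "z \<in> closed_cube k (par w)"
    using par_in v w closed_cube_par[of k 1] by auto
  \<comment> \<open>The points \<open>y\<close> and \<open>z\<close> are each within
    \<open>2 * D * r powi (k + 1)\<close> of their net points of level \<open>k + 1\<close>.
    Together this costs at most \<open>c / 8 * ?R\<close>, and the distance from \<open>y\<close> to
    \<open>z\<close> costs as much again.\<close>
  have "\<sigma> * ?R \<le> c / 8 * ?R"
    using sigma_c8 by (intro mult_right_mono) auto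
  with D_scale[of k]
  have "4 * (D * r powi (k + 1)) \<le> c / 8 * ?R" by linarith
  with closed_cube_dist[OF v(2)] closed_cube_dist[OF w(2)] assms
    dist_triangle3[of "x v" "x w" y] dist_triangle[of y "x w" z]
  have vw: "dist (x v) (x w) \<le> c / 4 * ?R"
    by linarith
  have KC: "(2 * C + c) * ?R \<le> K * ?R" using K_C by (intro mult_right_mono) auto
  have cC: "c * ?R < C * ?R" using c_C by simp
  have c0: "0 < c * ?R" using sigma_pos sigma_c by simp
  have KC': "2 * (C * ?R) + c * ?R \<le> K * ?R" using KC by (simp add: algebra_simps)
  have meet: "closed_cube k a \<inter> closed_cube k b \<noteq> {}" 
    if "a \<in> \<Omega> k" "b \<in> \<Omega> k" "dist (x a) (x b) \<le> K * ?R" for a b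
    using closed_cubes_meet that by blast
  \<comment> \<open>The middle index \<open>u\<close> is \<open>par v\<close> if both parents are
    near; otherwise it is the index that \<open>par_base\<close> supplies for a far parent.\<close>
  have "\<exists>u\<in>\<Omega> k. dist (x (par v)) (x u) \<le> K * ?R \<and> dist (x u) (x (par w)) \<le> K * ?R"
    using par_base[OF v(1)]
  proof (elim disjE bexE conjE)
    assume d: "dist (x v) (x (par v)) < C * ?R"
    show ?thesis using par_base[OF w(1)]
    proof (elim disjE bexE conjE)
      assume "dist (x w) (x (par w)) < C * ?R"
      then have "dist (x (par v)) (x (par w)) \<le> K * ?R"
        using d vw KC' c0 dist_triangle[of "x (par v)" "x (par w)" "x v"] dist_triangle[of "x v" "x (par w)" "x w"]
        by (simp add: dist_commute)
      then show ?thesis using pv(1) K_pos by (intro bexI[of _ "par v"]) auto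
    next
      fix b assume b: "b \<in> \<Omega> k" "dist (x w) (x b) < c / 4 * ?R" "dist (x b) (x (par w)) \<le> K * ?R"
      have "dist (x (par v)) (x b) \<le> K * ?R"
        using d vw KC' cC c0 b(2) dist_triangle3[of "x (par v)" "x b" "x v"] dist_triangle[of "x v" "x b" "x w"]
        by linarith
      then show ?thesis using b by blast
    qed
  next
    fix a assume a: "a \<in> \<Omega> k" "dist (x v) (x a) < c / 4 * ?R" "dist (x a) (x (par v)) \<le> K * ?R"
    show ?thesis using par_base[OF w(1)]
    proof (elim disjE bexE conjE)
      assume "dist (x w) (x (par w)) < C * ?R"
      then have "dist (x a) (x (par w)) \<le> K * ?R"
        using a(2) vw KC' cC c0 dist_triangle3[of "x a" "x (par w)" "x v"] dist_triangle[of "x v" "x (par w)" "x w"]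
        by linarith
      then show ?thesis using a by (auto simp: dist_commute)
    next
      fix b assume b: "b \<in> \<Omega> k" "dist (x w) (x b) < c / 4 * ?R" "dist (x b) (x (par w)) \<le> K * ?R"
      have "dist (x a) (x b) < c * ?R"
        using a vw c0 b(2) dist_triangle[of "x a" "x b" "x v"] dist_triangle[of "x v" "x b" "x w"]
        by (simp add: dist_commute)
      then have "a = b" using sep a(1) b(1) by fastforce
      then show ?thesis using a b by (auto simp: dist_commute)
    qed
  qed
  then obtain u where "u \<in> \<Omega> k" "dist (x (par v)) (x u) \<le> K * ?R" "dist (x u) (x (par w)) \<le> K * ?R"
    by blast
  then show ?thesis
    by (intro bexI[of _ "par v"] bexI[of _ u] bexI[of _ "par w"] conjI meet pv pw)
qed

section \<open>Assembling the cubes\<close>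

text \<open>The first constant is that of \<open>inner_ball_open_cube\<close>, the third that of
  \<open>close_points_linked\<close>. The second is \<open>3 * D\<close> because closed cubes reach
  up to distance \<open>2 * D * r powi k\<close> and must fit into an open ball.\<close>

lemma dyadic_cubes_exist: "\<exists>Q. dyadic_cubes (\<sigma> / 2) (3 * D) (c / 8) r \<Omega> x Q"
proof -
  have "\<exists>h. \<forall>y k. h y k \<in> \<Omega> k \<and> y \<in> closed_cube k (h y k) \<and> par (h y (k + 1)) = h y k"
    using exists_chain by (rule choice[OF allI])
  then obtain h where h: "\<And>y k. h y k \<in> \<Omega> k" "\<And>y k. y \<in> closed_cube k (h y k)"
    "\<And>y k. par (h y (k + 1)) = h y k" by blast
  have h_anc: "(par ^^ n) (h y (k + int n)) = h y k" for y k n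
  proof (induction n)
    case (Suc n)
    have "k + int (Suc n) = k + int n + 1" by simp
    then have "(par ^^ Suc n) (h y (k + int (Suc n))) = (par ^^ n) (h y (k + int n))"
      by (simp only: funpow_Suc_right o_apply h(3))
    then show ?case using Suc by (simp only:)
  qed simp
  \<comment> \<open>No level is recorded here: since the sets \<open>\<Omega> k\<close> are
    disjoint, a chain can pass through \<open>\<omega>\<close> only at the level of
    \<open>\<omega>\<close>.\<close>
  define Q where "Q \<omega> = {y. \<exists>k. h y k = \<omega>}" for \<omega>
  have in_Q: "y \<in> Q \<omega> \<longleftrightarrow> h y k = \<omega>" if "\<omega> \<in> \<Omega> k" for y \<omega> k
  proof
    assume "y \<in> Q \<omega>"
    then obtain j where "h y j = \<omega>" by (auto simp: Q_def)
    with h(1)[of y j] that disj have "j = k" by (auto simp: disjoint_family_on_def)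
    then show "h y k = \<omega>" using \<open>h y j = \<omega>\<close> by simp
  qed (auto simp: Q_def)
  \<comment> \<open>A point of the open cube of \<open>\<omega>\<close> lies in no other closed cube
    of level \<open>k\<close>, so its chain must pass through \<open>\<omega>\<close>.\<close>
  have Q_bounds: "open_cube k \<omega> \<subseteq> Q \<omega>" "Q \<omega> \<subseteq> closed_cube k \<omega>" if "\<omega> \<in> \<Omega> k" for \<omega> k
    using in_Q[OF that] h(1,2)[of _ k] unfolding open_cube_def by fastforce+
  note Q_topology = between_open_closed_cube[OF _ Q_bounds]
  have D1: "(\<Union>\<omega>\<in>\<Omega> k. Q \<omega>) = UNIV" for k
    using h(1) in_Q by blast
  have D3: "Q \<omega> \<subseteq> Q \<mu> \<or> Q \<omega> \<inter> Q \<mu> = {}" if "k \<le> l" "\<omega> \<in> \<Omega> l" "\<mu> \<in> \<Omega> k" for k l \<omega> \<mu>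
  proof -
    \<comment> \<open>The chains of all points of \<open>Q \<omega>\<close> have the same index at
      the coarser level \<open>k\<close>, so either all or none of them pass through
      \<open>\<mu>\<close>.\<close>
    have "h y k = (par ^^ nat (l - k)) \<omega>" if "y \<in> Q \<omega>" for y
      using h_anc[of "nat (l - k)" y k] in_Q[OF \<open>\<omega> \<in> \<Omega> l\<close>] that \<open>k \<le> l\<close> by simp
    then show ?thesis using in_Q[OF \<open>\<mu> \<in> \<Omega> k\<close>] by auto
  qed
  have D4: "Q \<omega> \<subseteq> ball (x \<omega>) (3 * D * r powi k)" if "\<omega> \<in> \<Omega> k" for k \<omega>
  proof
    fix y assume "y \<in> Q \<omega>"
    then have "dist (x \<omega>) y \<le> 2 * D * r powi k"
      using Q_bounds(2)[OF that] closed_cube_dist[of y k \<omega>] by (auto simp: dist_commute)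
    moreover have "0 < D * r powi k" using D_pos by simp
    ultimately show "y \<in> ball (x \<omega>) (3 * D * r powi k)" by simp
  qed
  have "dyadic_cubes (\<sigma> / 2) (3 * D) (c / 8) r \<Omega> x Q"
    unfolding dyadic_cubes_def
  proof (intro conjI allI ballI impI)
    fix k \<omega> assume w: "\<omega> \<in> \<Omega> k"
    show "interior (Q \<omega>) = interior (closure (Q \<omega>))" "closure (interior (Q \<omega>)) = closure (Q \<omega>)"
      using w by (simp_all add: Q_topology[OF w w w] interior_closed_cube closure_open_cube)
    show "ball (x \<omega>) (\<sigma> / 2 * r powi k) \<subseteq> Q \<omega>"
      using inner_ball_open_cube[OF w] Q_bounds(1)[OF w] by blast
  next
    fix k and y z :: 'a assume "dist y z \<le> c / 8 * r powi k"
    from close_points_linked[OF this]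
    show "\<exists>\<omega>0\<in>\<Omega> k. \<exists>\<omega>1\<in>\<Omega> k. \<exists>\<omega>2\<in>\<Omega> k.
           closure (Q \<omega>0) \<inter> closure (Q \<omega>1) \<noteq> {} \<and> closure (Q \<omega>1) \<inter> closure (Q \<omega>2) \<noteq> {} \<and>
           y \<in> closure (Q \<omega>0) \<and> z \<in> closure (Q \<omega>2)"
      using Q_topology(1) by (metis (no_types, lifting))
  qed (use D1 D3 D4 in auto)
  then show ?thesis by blast
qed

end

section \<open>Counting separated points in doubling spaces\<close>

lemma doubling_iterate:
  assumes N: "\<And>(x::'a::metric_space) r. 0 < r \<Longrightarrow>
      \<exists>p::nat \<Rightarrow> 'a. ball x (2 * r) \<subseteq> (\<Union>i\<in>{1..N}. ball (p i) r)"
    and "0 < r"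
  shows "\<exists>P::'a set. finite P \<and> card P \<le> N ^ n \<and> ball x (2 ^ n * r) \<subseteq> (\<Union>p\<in>P. ball p r)"
proof (induction n arbitrary: x)
  case 0
  show ?case by (intro exI[of _ "{x}"]) simp
next
  case (Suc n)
  obtain q :: "nat \<Rightarrow> 'a" where q: "ball x (2 * (2 ^ n * r)) \<subseteq> (\<Union>i\<in>{1..N}. ball (q i) (2 ^ n * r))"
    using N[of "2 ^ n * r" x] \<open>0 < r\<close> by auto
  have "\<forall>i. \<exists>P. finite P \<and> card P \<le> N ^ n \<and> ball (q i) (2 ^ n * r) \<subseteq> (\<Union>p\<in>P. ball p r)"
    using Suc.IH by blast
  then obtain P where P: "\<And>i. finite (P i)" "\<And>i. card (P i) \<le> N ^ n"
      "\<And>i. ball (q i) (2 ^ n * r) \<subseteq> (\<Union>p\<in>P i. ball p r)" by metis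
  have "card (\<Union>i\<in>{1..N}. P i) \<le> (\<Sum>i\<in>{1..N}. card (P i))"
    by (rule card_UN_le) simp
  also have "\<dots> \<le> N * N ^ n"
    using sum_bounded_above[of "{1..N}" "\<lambda>i. card (P i)" "N ^ n"] P(2) by simp
  finally have "card (\<Union>i\<in>{1..N}. P i) \<le> N ^ Suc n" by simp
  moreover have "ball x (2 ^ Suc n * r) \<subseteq> (\<Union>p\<in>(\<Union>i\<in>{1..N}. P i). ball p r)"
  proof
    fix y assume "y \<in> ball x (2 ^ Suc n * r)"
    then have "y \<in> ball x (2 * (2 ^ n * r))" by (simp add: mult.assoc)
    then obtain i where i: "i \<in> {1..N}" "y \<in> ball (q i) (2 ^ n * r)" using q by blast
    then show "y \<in> (\<Union>p\<in>(\<Union>i\<in>{1..N}. P i). ball p r)" using P(3)[of i] by blast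
  qed
  ultimately show ?case using P(1) by (intro exI[of _ "\<Union>i\<in>{1..N}. P i"]) simp
qed

text \<open>A ball of radius \<open>\<rho> / 2\<close> contains at most one point of a
  \<open>\<rho>\<close>-separated family, and \<open>N ^ n\<close> such balls suffice. As
  \<open>n\<close> depends only on \<open>t\<close>, the bound is the same at all scales, so that
  one number serves all levels.\<close>

lemma doubling_separated_card:
  assumes "doubling_space TYPE('a::metric_space)"
  shows "\<exists>M. \<forall>(y::'a) \<rho> S (x::'i \<Rightarrow> 'a). 0 < \<rho> \<longrightarrow>
           (\<forall>a\<in>S. \<forall>b\<in>S. a \<noteq> b \<longrightarrow> \<rho> \<le> dist (x a) (x b)) \<longrightarrow> (\<forall>a\<in>S. dist y (x a) \<le> t * \<rho>) \<longrightarrow>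
           finite S \<and> card S \<le> M"
proof -
  obtain N where N: "\<And>(x::'a) r. 0 < r \<Longrightarrow>
      \<exists>p::nat \<Rightarrow> 'a. ball x (2 * r) \<subseteq> (\<Union>i\<in>{1..N}. ball (p i) r)"
    using assms unfolding doubling_space_def by blast
  obtain n where n: "2 * t < 2 ^ n"
    using real_arch_pow[of 2 "2 * t"] by auto
  have "finite S \<and> card S \<le> N ^ n"
    if \<rho>: "0 < \<rho>" and sep: "\<forall>a\<in>S. \<forall>b\<in>S. a \<noteq> b \<longrightarrow> \<rho> \<le> dist (x a) (x b)"
      and S: "\<forall>a\<in>S. dist y (x a) \<le> t * \<rho>"
    for y :: 'a and \<rho> S and x :: "'i \<Rightarrow> 'a"
  proof -
    obtain P where P: "finite P" "card P \<le> N ^ n" "ball y (2 ^ n * (\<rho> / 2)) \<subseteq> (\<Union>p\<in>P. ball p (\<rho> / 2))"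
      using doubling_iterate[OF N, of "\<rho> / 2" n y] \<rho> by auto
    have "t * \<rho> < 2 ^ n * (\<rho> / 2)" using mult_strict_right_mono[OF n \<rho>] by simp
    then have "\<forall>a\<in>S. \<exists>p\<in>P. dist p (x a) < \<rho> / 2"
      using S P(3) by (fastforce simp: subset_eq)
    then obtain f where f: "\<And>a. a \<in> S \<Longrightarrow> f a \<in> P" "\<And>a. a \<in> S \<Longrightarrow> dist (f a) (x a) < \<rho> / 2"
      by metis
    have "inj_on f S"
    proof (rule inj_onI, rule ccontr)
      fix a b assume ab: "a \<in> S" "b \<in> S" "f a = f b" "a \<noteq> b"
      then show False
        using sep f(2)[of a] f(2)[of b] dist_triangle3[of "x a" "x b" "f a"] by fastforce
    qed
    then show ?thesis
      using f(1) P(1,2) card_inj_on_le[of f S P] finite_imageD[of f S]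
      by (meson finite_subset image_subsetI order_trans)
  qed
  then show ?thesis by (intro exI[of _ "N ^ n"] allI impI)
qed

section \<open>Close pairs from uniform perfectness\<close>

text \<open>The point \<open>z\<close> witnesses that the ball is not the whole space.\<close>

lemma uniformly_perfect_annulus:
  assumes "\<And>(x::'a::metric_space) r. 0 < r \<Longrightarrow> ball x r \<noteq> UNIV \<Longrightarrow> ball x (\<gamma> * r) - ball x r \<noteq> {}"
    and "0 < r" "r \<le> dist x z"
  obtains y :: "'a::metric_space" where "r \<le> dist x y" "dist x y < \<gamma> * r"
proof -
  have "z \<notin> ball x r" using assms(3) by simp
  then have "ball x r \<noteq> UNIV" by blast
  from assms(1)[OF assms(2) this] obtain y where "y \<in> ball x (\<gamma> * r)" "y \<notin> ball x r" by blast
  then show ?thesis using that[of y] by (simp add: not_less)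
qed

text \<open>These pairs become the exceptions around \<open>a\<close>: \<open>s i\<close> will be
  given to a neighbour of \<open>a\<close>, while \<open>t i\<close> stays with \<open>a\<close>.
  Uniform perfectness is used twice, at radius \<open>\<rho> i\<close> around \<open>a\<close> to
  find a place for the \<open>i\<close>-th pair, and at radius \<open>\<epsilon>\<close> to find a
  second net point beside the first. The assumption \<open>far\<close> ensures that the annuli
  around \<open>a\<close> are not empty.\<close>

lemma separated_close_pairs:
  fixes x :: "'i \<Rightarrow> 'a::metric_space"
  assumes perfect: "\<And>(x::'a) r. 0 < r \<Longrightarrow> ball x r \<noteq> UNIV \<Longrightarrow> ball x (\<gamma> * r) - ball x r \<noteq> {}"
    and "1 < \<gamma>" "0 < \<delta>" "0 < \<epsilon>" and small: "8 * (\<gamma> + 4) * \<epsilon> \<le> \<delta>"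
    and cover: "\<And>y. \<exists>\<omega>\<in>A. dist y (x \<omega>) < \<epsilon>"
    and far: "\<delta> * (2 * \<gamma>) ^ M \<le> dist a z"
  shows "\<exists>s t. \<forall>i<M. s i \<in> A \<and> t i \<in> A \<and> s i \<noteq> t i \<and> dist (x (s i)) (x (t i)) \<le> (\<gamma> + 3) * \<epsilon> \<and>
           \<delta> / 2 \<le> dist a (x (s i)) \<and> dist a (x (s i)) < \<delta> * (2 * \<gamma>) ^ M \<and> dist a (x (t i)) < \<delta> * (2 * \<gamma>) ^ M \<and>
           (\<forall>j<M. j \<noteq> i \<longrightarrow> s i \<noteq> s j \<and> s i \<noteq> t j)"
proof -
  \<comment> \<open>The annuli \<open>\<rho> i \<le> dist a q < \<gamma> * \<rho> i\<close> are at mutual distance at least \<open>\<delta>\<close>.\<close>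
  define \<rho> where "\<rho> i = \<delta> * (2 * \<gamma>) ^ i" for i
  have \<rho>_mono: "\<rho> i \<le> \<rho> j" if "i \<le> j" for i j
    using that \<open>1 < \<gamma>\<close> \<open>0 < \<delta>\<close> unfolding \<rho>_def by (intro mult_left_mono power_increasing) auto
  have \<rho>_0: "\<delta> \<le> \<rho> i" for i using \<rho>_mono[of 0 i] by (simp add: \<rho>_def)
  have \<rho>_Suc: "2 * (\<gamma> * \<rho> i) = \<rho> (Suc i)" for i by (simp add: \<rho>_def)
  have \<epsilon>: "8 * (\<gamma> * \<epsilon>) + 32 * \<epsilon> \<le> \<delta>" "\<epsilon> < \<gamma> * \<epsilon>"
    using small \<open>1 < \<gamma>\<close> \<open>0 < \<epsilon>\<close> by (simp_all add: algebra_simps)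
  have \<gamma>\<rho>: "\<rho> i \<le> \<gamma> * \<rho> i" for i
    using \<rho>_0[of i] \<open>0 < \<delta>\<close> \<open>1 < \<gamma>\<close> by simp
  have "\<exists>q u v. \<rho> i \<le> dist a q \<and> dist a q < \<gamma> * \<rho> i \<and> u \<in> A \<and> v \<in> A \<and> u \<noteq> v \<and> dist q (x u) < \<epsilon> \<and>
           dist (x u) (x v) < (\<gamma> + 1) * \<epsilon>" if "i < M" for i
  proof -
    have "\<rho> i \<le> dist a z" using far \<rho>_mono[of i M] that by (simp add: \<rho>_def)
    with \<rho>_0[of i] \<open>0 < \<delta>\<close> obtain q where q: "\<rho> i \<le> dist a q" "dist a q < \<gamma> * \<rho> i"
      using uniformly_perfect_annulus[OF perfect, of "\<rho> i" a z] by auto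
    obtain u where u: "u \<in> A" "dist q (x u) < \<epsilon>" using cover by blast
    \<comment> \<open>Now \<open>a\<close> witnesses that \<open>ball (x u) \<epsilon>\<close> is
      not the whole space. The point \<open>y\<close> found outside this ball has a net point within
      \<open>\<epsilon>\<close>, which therefore cannot be \<open>x u\<close>.\<close>
    have "\<epsilon> \<le> dist (x u) a"
      using \<rho>_0[of i] q u(2) \<epsilon> \<open>0 < \<epsilon>\<close> dist_triangle2[of a q "x u"] dist_commute[of a "x u"] by linarith
    then obtain y where y: "\<epsilon> \<le> dist (x u) y" "dist (x u) y < \<gamma> * \<epsilon>"
      using uniformly_perfect_annulus[OF perfect \<open>0 < \<epsilon>\<close>] by blast
    obtain v where v: "v \<in> A" "dist y (x v) < \<epsilon>" using cover by blast
    have "u \<noteq> v" using y(1) v(2) by (auto simp: dist_commute)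
    moreover have "dist (x u) (x v) < (\<gamma> + 1) * \<epsilon>"
      using y(2) v(2) dist_triangle[of "x u" "x v" y] by (simp add: algebra_simps)
    ultimately show ?thesis using q u v by blast
  qed
  then have "\<forall>i. \<exists>q u v. i < M \<longrightarrow> \<rho> i \<le> dist a q \<and> dist a q < \<gamma> * \<rho> i \<and> u \<in> A \<and> v \<in> A \<and> u \<noteq> v \<and>
           dist q (x u) < \<epsilon> \<and> dist (x u) (x v) < (\<gamma> + 1) * \<epsilon>" by blast
  then obtain q s t where "\<forall>i. i < M \<longrightarrow> \<rho> i \<le> dist a (q i) \<and> dist a (q i) < \<gamma> * \<rho> i \<and>
           s i \<in> A \<and> t i \<in> A \<and> s i \<noteq> t i \<and>
           dist (q i) (x (s i)) < \<epsilon> \<and> dist (x (s i)) (x (t i)) < (\<gamma> + 1) * \<epsilon>"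
    unfolding choice_iff by blast
  then have qst: "\<And>i. i < M \<Longrightarrow> \<rho> i \<le> dist a (q i)" "\<And>i. i < M \<Longrightarrow> dist a (q i) < \<gamma> * \<rho> i"
    "\<And>i. i < M \<Longrightarrow> s i \<in> A" "\<And>i. i < M \<Longrightarrow> t i \<in> A" "\<And>i. i < M \<Longrightarrow> s i \<noteq> t i"
    "\<And>i. i < M \<Longrightarrow> dist (q i) (x (s i)) < \<epsilon>" "\<And>i. i < M \<Longrightarrow> dist (x (s i)) (x (t i)) < (\<gamma> + 1) * \<epsilon>"
    by blast+
  have qt: "dist (q i) (x (t i)) < \<gamma> * \<epsilon> + 2 * \<epsilon>" if "i < M" for i
    using qst(6,7)[OF that] dist_triangle[of "q i" "x (t i)" "x (s i)"] by (simp add: algebra_simps)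
  have q_sep': "\<delta> \<le> dist (q i) (q j)" if "i < j" "j < M" for i j
  proof -
    \<comment> \<open>The outer radius of one annulus is half of the next inner radius, which leaves
      a gap of at least \<open>\<gamma> * \<rho> i\<close>, hence of at least
      \<open>\<delta>\<close>.\<close>
    have "2 * (\<gamma> * \<rho> i) \<le> \<rho> j" using \<rho>_mono[of "Suc i" j] that by (simp add: \<rho>_Suc)
    then show ?thesis
      using qst(2)[of i] qst(1)[of j] that dist_triangle[of a "q j" "q i"] \<rho>_0[of i] \<gamma>\<rho>[of i] by linarith
  qed
  have q_sep: "\<delta> \<le> dist (q i) (q j)" if "i \<noteq> j" "i < M" "j < M" for i j
    using q_sep'[of i j] q_sep'[of j i] that by (cases i j rule: linorder_cases) (auto simp: dist_commute)
  have "s i \<in> A \<and> t i \<in> A \<and> s i \<noteq> t i \<and> dist (x (s i)) (x (t i)) \<le> (\<gamma> + 3) * \<epsilon> \<and>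
           \<delta> / 2 \<le> dist a (x (s i)) \<and> dist a (x (s i)) < \<rho> M \<and> dist a (x (t i)) < \<rho> M \<and>
           (\<forall>j<M. j \<noteq> i \<longrightarrow> s i \<noteq> s j \<and> s i \<noteq> t j)" if i: "i < M" for i
  proof (intro conjI allI impI)
    have "2 * (\<gamma> * \<rho> i) \<le> \<rho> M" using \<rho>_mono[of "Suc i" M] i by (simp add: \<rho>_Suc)
    note bounds = this qst(1,2,6)[OF i] qt[OF i] \<rho>_0[of i] \<rho>_0[of M] \<epsilon> \<open>0 < \<epsilon>\<close> \<open>0 < \<delta>\<close>
    show "s i \<in> A" "t i \<in> A" "s i \<noteq> t i" using qst i by auto
    show "dist (x (s i)) (x (t i)) \<le> (\<gamma> + 3) * \<epsilon>"
      using qst(7)[OF i] \<open>0 < \<epsilon>\<close> by (simp add: algebra_simps)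
    show "\<delta> / 2 \<le> dist a (x (s i))"
      using bounds dist_triangle2[of a "q i" "x (s i)"] by linarith
    show "dist a (x (s i)) < \<rho> M"
      using bounds dist_triangle[of a "x (s i)" "q i"] by linarith
    show "dist a (x (t i)) < \<rho> M"
      using bounds dist_triangle[of a "x (t i)" "q i"] by linarith
    fix j assume j: "j < M" "j \<noteq> i"
    show "s i \<noteq> s j"
    proof
      assume "s i = s j"
      then have "dist (q i) (q j) < 2 * \<epsilon>"
        using qst(6)[OF i] qst(6)[OF j(1)] dist_triangle2[of "q i" "q j" "x (s i)"] by simp
      moreover have "\<delta> \<le> dist (q i) (q j)" using q_sep i j by auto
      ultimately show False using \<epsilon> \<open>0 < \<epsilon>\<close> by linarith
    qed
    show "s i \<noteq> t j"
    proof
      assume "s i = t j"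
      then show False
        using bounds qt[OF j(1)] q_sep[of i j] i j dist_triangle2[of "q i" "q j" "x (s i)"] by simp
    qed
  qed
  then show ?thesis unfolding \<rho>_def by blast
qed

section \<open>Parents between two consecutive levels\<close>

text \<open>Here \<open>A\<close> and \<open>A'\<close> are two consecutive levels and the constants
  include the scale. The neighbours of \<open>a\<close> are numbered by \<open>e a\<close> below
  \<open>M\<close>; for the neighbour \<open>b\<close> with number \<open>i\<close>, the index
  \<open>s a i\<close> gets the parent \<open>b\<close> and \<open>t a i\<close> keeps the parent
  \<open>a\<close>. All other indices get a near parent \<open>d\<close>.\<close>

lemma exists_parent_map:
  fixes x :: "'i \<Rightarrow> 'a::metric_space"
  assumes perfect: "\<And>(x::'a) r. 0 < r \<Longrightarrow> ball x r \<noteq> UNIV \<Longrightarrow> ball x (\<gamma> * r) - ball x r \<noteq> {}"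
    and \<gamma>: "1 < \<gamma>" and c: "0 < c" "c < C" and \<epsilon>: "0 < \<epsilon>"
    and small: "8 * (\<gamma> + 4) * \<epsilon> \<le> \<delta>" and \<delta>: "\<delta> * (2 * \<gamma>) ^ M = c / 8"
    and sep: "\<And>a b. a \<in> A \<Longrightarrow> b \<in> A \<Longrightarrow> a \<noteq> b \<Longrightarrow> c \<le> dist (x a) (x b)"
    and cover: "\<And>y. \<exists>a\<in>A. dist y (x a) < C"
    and cover': "\<And>y. \<exists>\<omega>\<in>A'. dist y (x \<omega>) < \<epsilon>"
    and card: "\<And>a. a \<in> A \<Longrightarrow> finite {b \<in> A. dist (x a) (x b) \<le> (\<gamma> + 3) * C} \<and>
                  card {b \<in> A. dist (x a) (x b) \<le> (\<gamma> + 3) * C} \<le> M"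
  shows "\<exists>p. (\<forall>\<omega>\<in>A'. p \<omega> \<in> A \<and> dist (x \<omega>) (x (p \<omega>)) \<le> (\<gamma> + 4) * C \<and>
                  (\<forall>a\<in>A. dist (x \<omega>) (x a) < \<delta> / 2 \<longrightarrow> p \<omega> = a) \<and>
                  (dist (x \<omega>) (x (p \<omega>)) < C \<or>
                   (\<exists>a\<in>A. dist (x \<omega>) (x a) < c / 4 \<and> dist (x a) (x (p \<omega>)) \<le> (\<gamma> + 3) * C))) \<and>
             (\<forall>a\<in>A. \<forall>b\<in>A. dist (x a) (x b) \<le> (\<gamma> + 3) * C \<longrightarrow>
                (\<exists>a'\<in>A'. \<exists>b'\<in>A'. p a' = a \<and> p b' = b \<and> dist (x a') (x b') \<le> (\<gamma> + 3) * \<epsilon>))"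
proof -
  define nb where "nb a = {b \<in> A. b \<noteq> a \<and> dist (x a) (x b) \<le> (\<gamma> + 3) * C}" for a
  have "0 < 8 * (\<gamma> + 4) * \<epsilon>" using \<gamma> \<epsilon> by simp
  then have \<delta>0: "0 < \<delta>" using small by linarith
  have "\<delta> * 1 \<le> \<delta> * (2 * \<gamma>) ^ M"
    using \<delta>0 \<gamma> by (intro mult_left_mono one_le_power) auto
  then have \<delta>c: "\<delta> \<le> c / 8" using \<delta> by simp
  have "\<exists>e s t. a \<in> A \<and> nb a \<noteq> {} \<longrightarrow> inj_on e (nb a) \<and> e ` nb a \<subseteq> {..<M} \<and>
          (\<forall>i<M. s i \<in> A' \<and> t i \<in> A' \<and> s i \<noteq> t i \<and> dist (x (s i)) (x (t i)) \<le> (\<gamma> + 3) * \<epsilon> \<and>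
           \<delta> / 2 \<le> dist (x a) (x (s i)) \<and> dist (x a) (x (s i)) < c / 8 \<and> dist (x a) (x (t i)) < c / 8 \<and>
           (\<forall>j<M. j \<noteq> i \<longrightarrow> s i \<noteq> s j \<and> s i \<noteq> t j))" for a
  proof (cases "a \<in> A \<and> nb a \<noteq> {}")
    case True
    have nb: "nb a \<subseteq> {b \<in> A. dist (x a) (x b) \<le> (\<gamma> + 3) * C}" by (auto simp: nb_def)
    then have fin: "finite (nb a)" and "card (nb a) \<le> M"
      using card[of a] True by (meson finite_subset card_mono order_trans)+
    moreover obtain e where "bij_betw e (nb a) {0..<card (nb a)}"
      using ex_bij_betw_finite_nat[OF fin] by blast
    ultimately have e: "inj_on e (nb a)" "e ` nb a \<subseteq> {..<M}"
      by (auto simp: bij_betw_def)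
    \<comment> \<open>Any neighbour is at distance at least \<open>c\<close> from \<open>a\<close>,
      so it is the far point that \<open>separated_close_pairs\<close> requires.\<close>
    obtain b where "b \<in> nb a" using True by blast
    then have "c \<le> dist (x a) (x b)" using sep True by (auto simp: nb_def)
    then have "\<delta> * (2 * \<gamma>) ^ M \<le> dist (x a) (x b)" using \<delta> c by simp
    from separated_close_pairs[OF perfect \<gamma> \<delta>0 \<epsilon> small cover' this]
    show ?thesis using e unfolding \<delta> by blast
  qed blast
  then obtain e s t where est: "\<And>a. a \<in> A \<Longrightarrow> nb a \<noteq> {} \<Longrightarrow> inj_on (e a) (nb a) \<and> e a ` nb a \<subseteq> {..<M} \<and>
          (\<forall>i<M. s a i \<in> A' \<and> t a i \<in> A' \<and> s a i \<noteq> t a i \<and> dist (x (s a i)) (x (t a i)) \<le> (\<gamma> + 3) * \<epsilon> \<and>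
           \<delta> / 2 \<le> dist (x a) (x (s a i)) \<and> dist (x a) (x (s a i)) < c / 8 \<and> dist (x a) (x (t a i)) < c / 8 \<and>
           (\<forall>j<M. j \<noteq> i \<longrightarrow> s a i \<noteq> s a j \<and> s a i \<noteq> t a j))"
    by metis
  \<comment> \<open>\<open>swap \<omega> a b\<close>: the index \<open>\<omega>\<close> near \<open>a\<close> is given away to the neighbour \<open>b\<close>.\<close>
  define swap where "swap \<omega> a b \<longleftrightarrow> a \<in> A \<and> b \<in> nb a \<and> \<omega> = s a (e a b)" for \<omega> a b
  have idx: "e a b < M" if "a \<in> A" "b \<in> nb a" for a b
    using est[of a] that by blast
  have pairs: "s a (e a b) \<in> A' \<and> t a (e a b) \<in> A' \<and> dist (x (s a (e a b))) (x (t a (e a b))) \<le> (\<gamma> + 3) * \<epsilon> \<and>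
      \<delta> / 2 \<le> dist (x a) (x (s a (e a b))) \<and> dist (x a) (x (s a (e a b))) < c / 8 \<and>
      dist (x a) (x (t a (e a b))) < c / 8" if "a \<in> A" "b \<in> nb a" for a b
    using est[of a] idx[OF that] that by blast
  have swap_near: "\<delta> / 2 \<le> dist (x a) (x \<omega>)" "dist (x a) (x \<omega>) < c / 8" "a \<in> A" "b \<in> A"
      "dist (x a) (x b) \<le> (\<gamma> + 3) * C" if "swap \<omega> a b" for \<omega> a b
    using pairs[of a b] that unfolding swap_def nb_def by auto
  have near_unique: "a = a'" if "a \<in> A" "a' \<in> A" "dist (x \<omega>) (x a) < c / 4" "dist (x \<omega>) (x a') < c / 4" for a a' \<omega>
    using sep[of a a'] that dist_triangle3[of "x a" "x a'" "x \<omega>"] c by fastforce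
  \<comment> \<open>An index given away lies within \<open>c / 8\<close> of \<open>a\<close>, which
    determines \<open>a\<close>; its position among the \<open>s a i\<close> determines the number,
    and injectivity of \<open>e a\<close> the neighbour.\<close>
  have swap_unique: "a = a' \<and> b = b'" if "swap \<omega> a b" "swap \<omega> a' b'" for \<omega> a b a' b'
  proof -
    have "a = a'" using near_unique[of a a' \<omega>] swap_near[OF that(1)] swap_near[OF that(2)] c
      by (simp add: dist_commute)
    moreover have "e a b = e a b'"
    proof (rule ccontr)
      assume "e a b \<noteq> e a b'"
      then show False
        using est[of a] idx[of a b] idx[of a b'] that \<open>a = a'\<close> unfolding swap_def by (metis empty_iff)
    qed
    ultimately show ?thesis
      using est[of a] that unfolding swap_def by (metis empty_iff inj_onD)
  qed
  \<comment> \<open>The index \<open>t a i\<close> would have to be some \<open>s a j\<close>. For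
    equal numbers the two members of a pair differ, for different numbers the pairs are
    separated.\<close>
  have t_not_swap: "\<not> swap (t a (e a b)) a' b'" if "a \<in> A" "b \<in> nb a" for a b a' b'
  proof
    assume sw: "swap (t a (e a b)) a' b'"
    then have "a = a'"
      using near_unique[of a a' "t a (e a b)"] swap_near[OF sw] pairs[OF that] that c by (simp add: dist_commute)
    then show False
      using est[of a] idx[of a b] idx[of a b'] that sw unfolding swap_def by (metis empty_iff)
  qed
  \<comment> \<open>The default parent is the index within \<open>c / 4\<close>, unique by
    separation, if there is one, and otherwise any index within \<open>C\<close>.\<close>
  have "\<exists>d\<in>A. dist (x \<omega>) (x d) < C \<and> (\<forall>a\<in>A. dist (x \<omega>) (x a) < c / 4 \<longrightarrow> d = a)" for \<omega>
  proof (cases "\<exists>a\<in>A. dist (x \<omega>) (x a) < c / 4")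
    case True
    then obtain d where d: "d \<in> A" "dist (x \<omega>) (x d) < c / 4" by blast
    then have "dist (x \<omega>) (x d) < C" using c by simp
    then show ?thesis using d near_unique by blast
  next
    case False
    then show ?thesis using cover[of "x \<omega>"] by blast
  qed
  then obtain d where d: "\<And>\<omega>. d \<omega> \<in> A" "\<And>\<omega>. dist (x \<omega>) (x (d \<omega>)) < C"
    "\<And>\<omega> a. a \<in> A \<Longrightarrow> dist (x \<omega>) (x a) < c / 4 \<Longrightarrow> d \<omega> = a" by metis
  define p where "p \<omega> = (if \<exists>a b. swap \<omega> a b then SOME b. \<exists>a. swap \<omega> a b else d \<omega>)" for \<omega>
  have p_swap: "p \<omega> = b" if "swap \<omega> a b" for \<omega> a b
    unfolding p_def using that swap_unique by (auto intro!: some_equality)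
  have p_default: "p \<omega> = d \<omega>" if "\<And>a b. \<not> swap \<omega> a b" for \<omega>
    using that by (simp add: p_def)
  have C: "0 < C" "C \<le> (\<gamma> + 4) * C" "(\<gamma> + 3) * C + C = (\<gamma> + 4) * C"
    using c \<gamma> by (simp_all add: algebra_simps)
  \<comment> \<open>Indices given away keep distance \<open>\<delta> / 2\<close> from the
    \<open>a\<close> they are taken from, and any other index of \<open>A\<close> is too far away,
    so here the default parent applies.\<close>
  have p_near: "p \<omega> = a" if "a \<in> A" "dist (x \<omega>) (x a) < \<delta> / 2" for \<omega> a
  proof -
    have a: "dist (x \<omega>) (x a) < c / 4" using that \<delta>c c by simp
    have "\<not> swap \<omega> a' b" for a' b
    proof
      assume sw: "swap \<omega> a' b"
      then have "a' = a"
        using near_unique[of a' a \<omega>] swap_near[OF sw] that a c by (simp add: dist_commute)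
      then show False using swap_near(1)[OF sw] that by (simp add: dist_commute)
    qed
    then show ?thesis using p_default d(3)[OF that(1) a] by simp
  qed
  have P1: "p \<omega> \<in> A \<and> dist (x \<omega>) (x (p \<omega>)) \<le> (\<gamma> + 4) * C \<and>
        (dist (x \<omega>) (x (p \<omega>)) < C \<or>
         (\<exists>a\<in>A. dist (x \<omega>) (x a) < c / 4 \<and> dist (x a) (x (p \<omega>)) \<le> (\<gamma> + 3) * C))" for \<omega>
  proof (cases "\<exists>a b. swap \<omega> a b")
    case True
    then obtain a b where sw: "swap \<omega> a b" by blast
    note n = swap_near[OF sw]
    have "dist (x \<omega>) (x b) \<le> (\<gamma> + 4) * C"
      using n(2,5) C c dist_triangle3[of "x \<omega>" "x b" "x a"] by linarith
    moreover have "dist (x \<omega>) (x a) < c / 4" using n(2) c by (simp add: dist_commute)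
    ultimately show ?thesis using n p_swap[OF sw] by auto
  next
    case False
    then have "p \<omega> = d \<omega>" using p_default by blast
    moreover have "dist (x \<omega>) (x (d \<omega>)) \<le> (\<gamma> + 4) * C" using d(2)[of \<omega>] C(2) by linarith
    ultimately show ?thesis using d(1,2)[of \<omega>] by simp
  qed
  have P2: "\<exists>a'\<in>A'. \<exists>b'\<in>A'. p a' = a \<and> p b' = b \<and> dist (x a') (x b') \<le> (\<gamma> + 3) * \<epsilon>"
    if "a \<in> A" "b \<in> A" "dist (x a) (x b) \<le> (\<gamma> + 3) * C" for a b
  proof (cases "a = b")
    case True
    \<comment> \<open>A single index within \<open>\<epsilon>\<close> of \<open>a\<close> serves as
      both \<open>a'\<close> and \<open>b'\<close>.\<close>
    obtain \<omega> where w: "\<omega> \<in> A'" "dist (x a) (x \<omega>) < \<epsilon>" using cover' by blast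
    have "0 < \<gamma> * \<epsilon>" using \<gamma> \<epsilon> by simp
    then have "\<epsilon> \<le> \<delta> / 2" using small \<epsilon> by (simp add: algebra_simps)
    then have "p \<omega> = a" using w p_near[OF that(1)] by (simp add: dist_commute)
    then show ?thesis using w True \<gamma> \<epsilon> by (intro bexI[of _ \<omega>]) auto
  next
    case False
    then have b: "b \<in> nb a" using that by (simp add: nb_def)
    note pr = pairs[OF that(1) b]
    have "dist (x (t a (e a b))) (x a) < c / 4" using pr c by (simp add: dist_commute)
    then have "p (t a (e a b)) = a"
      using p_default t_not_swap[OF that(1) b] d(3)[OF that(1)] by simp
    moreover have "p (s a (e a b)) = b" using p_swap that(1) b unfolding swap_def by blast
    ultimately show ?thesis using pr by (metis dist_commute)
  qed
  show ?thesis
  proof (intro exI[of _ p] conjI ballI impI)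
    fix \<omega>
    show "p \<omega> \<in> A" "dist (x \<omega>) (x (p \<omega>)) \<le> (\<gamma> + 4) * C"
      "dist (x \<omega>) (x (p \<omega>)) < C \<or>
         (\<exists>a\<in>A. dist (x \<omega>) (x a) < c / 4 \<and> dist (x a) (x (p \<omega>)) \<le> (\<gamma> + 3) * C)"
      using P1[of \<omega>] by simp_all
  qed (rule p_near P2; assumption)+
qed

section \<open>Choice of the constants\<close>

text \<open>The constants depend on each other in this order: \<open>K\<close> and \<open>D\<close>
  on \<open>\<gamma>\<close> and \<open>C\<close>, the number \<open>M\<close> of neighbours on
  \<open>K / c\<close>, then \<open>\<delta>\<close> on \<open>M\<close>, and finally
  \<open>r0\<close> on \<open>\<delta>\<close> and \<open>D\<close>. None of them depends on
  \<open>r\<close> or on the net.\<close>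

lemma dyadic_constants_exist:
  assumes doubling: "doubling_space TYPE('a::complete_space)"
    and "uniformly_perfect_space TYPE('a)"
    and c: "0 < c" "c < C"
  shows "\<exists>C1>0. \<exists>C2>0. \<exists>C3>0. \<exists>r0>0. dyadic_constants TYPE('i) TYPE('a) c C C1 C2 C3 r0"
proof -
  obtain \<gamma> where \<gamma>: "1 < \<gamma>"
    and perfect: "\<And>(x::'a) r. 0 < r \<Longrightarrow> ball x r \<noteq> UNIV \<Longrightarrow> ball x (\<gamma> * r) - ball x r \<noteq> {}"
    using assms(2) unfolding uniformly_perfect_space_def by blast
  define K where "K = (\<gamma> + 3) * C"
  define D where "D = (\<gamma> + 4) * C"
  obtain M where M: "\<And>(y::'a) \<rho> S (x::'i \<Rightarrow> 'a). 0 < \<rho> \<Longrightarrow>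
      \<forall>a\<in>S. \<forall>b\<in>S. a \<noteq> b \<longrightarrow> \<rho> \<le> dist (x a) (x b) \<Longrightarrow> \<forall>a\<in>S. dist y (x a) \<le> K / c * \<rho> \<Longrightarrow>
      finite S \<and> card S \<le> M"
    using doubling_separated_card[OF doubling, of "K / c"] by blast
  \<comment> \<open>With this value the outermost annulus radius is \<open>c / 8\<close>, so all
    exceptions taken from an index stay close to it.\<close>
  define \<delta> where "\<delta> = c / (8 * (2 * \<gamma>) ^ M)"
  have \<delta>: "\<delta> * (2 * \<gamma>) ^ M = c / 8" using \<gamma> by (simp add: \<delta>_def)
  have \<delta>0: "0 < \<delta>" using \<gamma> c by (simp add: \<delta>_def)
  have "\<delta> * 1 \<le> \<delta> * (2 * \<gamma>) ^ M"
    using \<delta>0 \<gamma> by (intro mult_left_mono one_le_power) auto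
  then have \<delta>c: "\<delta> \<le> c / 8" using \<delta> by simp
  have "0 < C" using c by simp
  moreover from this have "0 < \<gamma> * C" using \<gamma> by simp
  ultimately have D: "4 * C \<le> D" and K: "2 * C + c \<le> K" using c by (simp_all add: D_def K_def algebra_simps)
  have D0: "0 < D" using D \<open>0 < C\<close> by simp
  \<comment> \<open>The resulting bound \<open>8 * (D * r) \<le> \<delta>\<close> gives the
    smallness condition of \<open>exists_parent_map\<close> for \<open>C * r powi (k + 1)\<close>
    and also the locale condition on \<open>D\<close> and \<open>r\<close> with
    \<open>\<delta> / 2\<close> as \<open>\<sigma>\<close>.\<close>
  define r0 where "r0 = \<delta> / (8 * D)"
  have r0: "0 < r0" using \<delta>0 D0 by (simp add: r0_def)
  have "dyadic_constants TYPE('i) TYPE('a) c C (\<delta> / 2 / 2) (3 * D) (c / 8) r0"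
    unfolding dyadic_constants_def
  proof (intro allI impI, elim conjE)
    fix r and \<Omega> :: "int \<Rightarrow> 'i set" and x :: "'i \<Rightarrow> 'a"
    assume r: "0 < r" "r \<le> r0" and net: "net_system c C r \<Omega> x"
    have disj: "disjoint_family \<Omega>"
      and sep: "\<And>k \<omega> \<mu>. \<omega> \<in> \<Omega> k \<Longrightarrow> \<mu> \<in> \<Omega> k \<Longrightarrow> \<omega> \<noteq> \<mu> \<Longrightarrow> c * r powi k \<le> dist (x \<omega>) (x \<mu>)"
      and cover: "\<And>k y. \<exists>\<omega>\<in>\<Omega> k. dist y (x \<omega>) < C * r powi k"
      using net unfolding net_system_def by blast+
    have R: "0 < r powi k" for k using r by simp
    have powi_Suc: "r powi (k + 1) = r * r powi k" for k using r by (simp add: power_int_add)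
    have rD: "8 * (D * r) \<le> \<delta>"
      using r(2) D0 by (simp add: r0_def field_simps)
    define adm where "adm k p \<longleftrightarrow>
             (\<forall>\<omega>\<in>\<Omega> (k + 1). p \<omega> \<in> \<Omega> k \<and> dist (x \<omega>) (x (p \<omega>)) \<le> (\<gamma> + 4) * (C * r powi k) \<and>
                  (\<forall>a\<in>\<Omega> k. dist (x \<omega>) (x a) < \<delta> * r powi k / 2 \<longrightarrow> p \<omega> = a) \<and>
                  (dist (x \<omega>) (x (p \<omega>)) < C * r powi k \<or>
                   (\<exists>a\<in>\<Omega> k. dist (x \<omega>) (x a) < c * r powi k / 4 \<and>
                             dist (x a) (x (p \<omega>)) \<le> (\<gamma> + 3) * (C * r powi k)))) \<and>
             (\<forall>a\<in>\<Omega> k. \<forall>b\<in>\<Omega> k. dist (x a) (x b) \<le> (\<gamma> + 3) * (C * r powi k) \<longrightarrow>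
                (\<exists>a'\<in>\<Omega> (k + 1). \<exists>b'\<in>\<Omega> (k + 1). p a' = a \<and> p b' = b \<and>
                   dist (x a') (x b') \<le> (\<gamma> + 3) * (C * r powi (k + 1))))" for k and p :: "'i \<Rightarrow> 'i"
    have "\<exists>p. adm k p" for k
      unfolding adm_def
    proof (rule exists_parent_map)
      show "0 < c * r powi k" "0 < C * r powi (k + 1)" "c * r powi k < C * r powi k"
        using R c by auto
      have "8 * (D * r) * r powi k \<le> \<delta> * r powi k"
        using rD R[of k] by (intro mult_right_mono) auto
      then show "8 * (\<gamma> + 4) * (C * r powi (k + 1)) \<le> \<delta> * r powi k"
        by (simp add: powi_Suc D_def mult_ac)
      have "\<delta> * (2 * \<gamma>) ^ M * r powi k = c / 8 * r powi k" using \<delta> by simp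
      then show "\<delta> * r powi k * (2 * \<gamma>) ^ M = c * r powi k / 8" by (simp add: mult_ac)
      fix a assume "a \<in> \<Omega> k"
      have "(\<gamma> + 3) * (C * r powi k) = K / c * (c * r powi k)"
        using c by (simp add: K_def)
      then show "finite {b \<in> \<Omega> k. dist (x a) (x b) \<le> (\<gamma> + 3) * (C * r powi k)} \<and>
         card {b \<in> \<Omega> k. dist (x a) (x b) \<le> (\<gamma> + 3) * (C * r powi k)} \<le> M"
        using sep R[of k] c by (intro M[of "c * r powi k" _ x "x a"]) auto
    qed (rule perfect \<gamma> sep cover; assumption)+
    then obtain p where adm: "\<And>k. adm k (p k)" by metis
    note p = adm[unfolded adm_def, THEN conjunct1, rule_format]
    note p_edge = adm[unfolded adm_def, THEN conjunct2, rule_format]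
    \<comment> \<open>The maps \<open>p k\<close> of the separate levels are glued into one;
      disjointness of the sets \<open>\<Omega> k\<close> makes the level of an index unique.\<close>
    define par where "par \<omega> = p (THE k. \<omega> \<in> \<Omega> (k + 1)) \<omega>" for \<omega>
    have par: "par \<omega> = p k \<omega>" if "\<omega> \<in> \<Omega> (k + 1)" for k \<omega>
    proof -
      have "(THE k. \<omega> \<in> \<Omega> (k + 1)) = k"
      proof (rule the_equality)
        show "\<omega> \<in> \<Omega> (k + 1)" by fact
        fix j assume "\<omega> \<in> \<Omega> (j + 1)"
        then show "j = k" using that disjoint_family_onD[OF disj, of "j + 1" "k + 1"] by auto
      qed
      then show ?thesis by (simp add: par_def)
    qed
    interpret cube_hierarchy c C D K "\<delta> / 2" r \<Omega> x par
    proof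
      show "disjoint_family \<Omega>" "0 < r" "c < C" "2 * C + c \<le> K" "0 < \<delta> / 2" by fact+ (simp add: \<delta>0)
      show "8 * (\<delta> / 2) \<le> c" "\<delta> / 2 \<le> D" "4 * D * r \<le> \<delta> / 2"
        using \<delta>c c D rD \<delta>0 by auto
      have "8 * (D * r) \<le> D" using rD \<delta>c D c by linarith
      then have "D * (8 * r) \<le> D * 1" by simp
      then show "r \<le> 1 / 2" using D0 by (simp only: mult_le_cancel_left_pos)
      fix k
      show "finite {\<omega> \<in> \<Omega> k. dist y (x \<omega>) \<le> B}" for y B
      proof -
        \<comment> \<open>The counting lemma is applied with a ratio depending on \<open>B\<close>
          and \<open>k\<close>, since here only finiteness is wanted.\<close>
        define \<rho> where "\<rho> = c * r powi k"
        have "0 < \<rho>" using c R by (simp add: \<rho>_def)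
        obtain N where N: "\<And>(y::'a) \<rho> S (x::'i \<Rightarrow> 'a). 0 < \<rho> \<Longrightarrow>
            \<forall>a\<in>S. \<forall>b\<in>S. a \<noteq> b \<longrightarrow> \<rho> \<le> dist (x a) (x b) \<Longrightarrow> \<forall>a\<in>S. dist y (x a) \<le> B / (c * r powi k) * \<rho> \<Longrightarrow>
            finite S \<and> card S \<le> N"
          using doubling_separated_card[OF doubling, of "B / (c * r powi k)"] by blast
        show ?thesis
          by (rule N[THEN conjunct1, OF \<open>0 < \<rho>\<close>, of _ x y]) (use sep \<open>0 < \<rho>\<close> in \<open>auto simp: \<rho>_def\<close>)
      qed
      show "\<exists>\<omega>\<in>\<Omega> k. dist y (x \<omega>) < C * r powi k" for y by (rule cover)
      show "c * r powi k \<le> dist (x \<omega>) (x \<mu>)" if "\<omega> \<in> \<Omega> k" "\<mu> \<in> \<Omega> k" "\<omega> \<noteq> \<mu>" for \<omega> \<mu>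
        using sep that .
      fix \<omega>
      { assume w: "\<omega> \<in> \<Omega> (k + 1)"
        show "par \<omega> \<in> \<Omega> k" "dist (x \<omega>) (x (par \<omega>)) \<le> D * r powi k"
          using p[OF w] par[OF w] by (simp_all add: D_def mult.assoc)
        show "par \<omega> = \<mu>" if "\<mu> \<in> \<Omega> k" "dist (x \<omega>) (x \<mu>) < \<delta> / 2 * r powi k" for \<mu>
          using p[OF w] par[OF w] that by simp
        show "dist (x \<omega>) (x (par \<omega>)) < C * r powi k \<or>
          (\<exists>\<mu>\<in>\<Omega> k. dist (x \<omega>) (x \<mu>) < c / 4 * r powi k \<and> dist (x \<mu>) (x (par \<omega>)) \<le> K * r powi k)"
          using p[OF w] par[OF w] by (simp add: K_def mult.assoc) }
      show "\<exists>\<omega>'\<in>\<Omega> (k + 1). \<exists>\<mu>'\<in>\<Omega> (k + 1). par \<omega>' = \<omega> \<and> par \<mu>' = \<mu> \<and>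
              dist (x \<omega>') (x \<mu>') \<le> K * r powi (k + 1)"
        if "\<omega> \<in> \<Omega> k" "\<mu> \<in> \<Omega> k" "dist (x \<omega>) (x \<mu>) \<le> K * r powi k" for \<mu>
      proof -
        have "dist (x \<omega>) (x \<mu>) \<le> (\<gamma> + 3) * (C * r powi k)"
          using that(3) by (simp add: K_def mult.assoc)
        from p_edge[OF that(1,2) this] obtain a b where "a \<in> \<Omega> (k + 1)" "b \<in> \<Omega> (k + 1)"
          "p k a = \<omega>" "p k b = \<mu>" "dist (x a) (x b) \<le> (\<gamma> + 3) * (C * r powi (k + 1))" by blast
        then show ?thesis
          by (intro bexI[of _ a] bexI[of _ b]) (simp_all add: par K_def mult.assoc)
      qed
    qed
    show "\<exists>Q. dyadic_cubes (\<delta> / 2 / 2) (3 * D) (c / 8) r \<Omega> x Q"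
      by (rule dyadic_cubes_exist)
  qed
  moreover have "0 < \<delta> / 2 / 2" "0 < 3 * D" "0 < c / 8" using \<delta>0 D0 c by auto
  ultimately show ?thesis using r0 by blast
qed

section \<open>Change of the index type\<close>

text \<open>The conditions on the cubes see an index only through its level, its point and its cube.
  So the cubes for the indices \<open>(k, x \<omega>)\<close> can be pulled back to
  \<open>\<Omega>\<close>.\<close>

lemma dyadic_constants_reindex:
  assumes "0 < c" and const: "dyadic_constants TYPE(int \<times> 'a) TYPE('a::metric_space) c C C1 C2 C3 r0"
  shows "dyadic_constants TYPE('i) TYPE('a) c C C1 C2 C3 r0"
  unfolding dyadic_constants_def
proof (intro allI impI, elim conjE)
  fix r and \<Omega> :: "int \<Rightarrow> 'i set" and x :: "'i \<Rightarrow> 'a"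
  assume r: "0 < r" "r \<le> r0" and net: "net_system c C r \<Omega> x"
  have disj: "disjoint_family \<Omega>"
    and sep: "\<And>k \<omega> \<mu>. \<omega> \<in> \<Omega> k \<Longrightarrow> \<mu> \<in> \<Omega> k \<Longrightarrow> \<omega> \<noteq> \<mu> \<Longrightarrow> c * r powi k \<le> dist (x \<omega>) (x \<mu>)"
    and cover: "\<And>k y. \<exists>\<omega>\<in>\<Omega> k. dist y (x \<omega>) < C * r powi k"
    using net unfolding net_system_def by blast+
  \<comment> \<open>The level is part of the new index because the same point may occur at several
    levels, while the index sets must be disjoint.\<close>
  define \<Omega>' where "\<Omega>' k = (\<lambda>\<omega>. (k, x \<omega>)) ` \<Omega> k" for k
  have "net_system c C r \<Omega>' snd"
    unfolding net_system_def
  proof (intro conjI allI ballI impI)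
    show "disjoint_family \<Omega>'" by (auto simp: disjoint_family_on_def \<Omega>'_def)
    show "c * r powi k \<le> dist (snd \<omega>) (snd \<mu>)" if ne: "\<omega> \<in> \<Omega>' k" "\<mu> \<in> \<Omega>' k" "\<omega> \<noteq> \<mu>" for k \<omega> \<mu>
    proof -
      obtain a b where ab: "a \<in> \<Omega> k" "\<omega> = (k, x a)" "b \<in> \<Omega> k" "\<mu> = (k, x b)"
        using ne(1,2) unfolding \<Omega>'_def by blast
      moreover have "a \<noteq> b" using ne(3) ab by auto
      ultimately show ?thesis using sep by simp
    qed
    show "\<exists>\<omega>\<in>\<Omega>' k. dist y (snd \<omega>) < C * r powi k" for k y
      using cover[of k y] by (auto simp: \<Omega>'_def)
  qed
  then obtain Q' where Q': "dyadic_cubes C1 C2 C3 r \<Omega>' snd Q'"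
    using const r unfolding dyadic_constants_def by blast
  note D5 = Q'[unfolded dyadic_cubes_def, THEN conjunct2, THEN conjunct2, THEN conjunct2, THEN conjunct2, rule_format]
  define Q where "Q \<omega> = Q' (THE k. \<omega> \<in> \<Omega> k, x \<omega>)" for \<omega>
  have Q: "Q \<omega> = Q' (k, x \<omega>)" if "\<omega> \<in> \<Omega> k" for k \<omega>
  proof -
    have "(THE k. \<omega> \<in> \<Omega> k) = k"
      using that disj by (intro the_equality) (auto simp: disjoint_family_on_def)
    then show ?thesis by (simp add: Q_def)
  qed
  have \<Omega>': "(k, x \<omega>) \<in> \<Omega>' k" if "\<omega> \<in> \<Omega> k" for k \<omega>
    using that by (simp add: \<Omega>'_def)
  have "dyadic_cubes C1 C2 C3 r \<Omega> x Q"
    unfolding dyadic_cubes_def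
  proof (intro conjI allI ballI impI)
    fix k
    have "(\<Union>\<omega>\<in>\<Omega> k. Q \<omega>) = (\<Union>\<omega>\<in>\<Omega>' k. Q' \<omega>)"
      unfolding \<Omega>'_def image_image by (rule SUP_cong[OF refl Q])
    then show "(\<Union>\<omega>\<in>\<Omega> k. Q \<omega>) = UNIV"
      using Q' by (simp add: dyadic_cubes_def)
    { fix \<omega> assume w: "\<omega> \<in> \<Omega> k"
      show "interior (Q \<omega>) = interior (closure (Q \<omega>))" "closure (interior (Q \<omega>)) = closure (Q \<omega>)"
        "ball (x \<omega>) (C1 * r powi k) \<subseteq> Q \<omega>" "Q \<omega> \<subseteq> ball (x \<omega>) (C2 * r powi k)"
        unfolding Q[OF w] using Q' \<Omega>'[OF w] unfolding dyadic_cubes_def by fastforce+ }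
    { fix l \<omega> \<mu> assume "k \<le> l" and w: "\<omega> \<in> \<Omega> l" and m: "\<mu> \<in> \<Omega> k"
      then show "Q \<omega> \<subseteq> Q \<mu> \<or> Q \<omega> \<inter> Q \<mu> = {}"
        unfolding Q[OF w] Q[OF m] using Q' \<Omega>'[OF w] \<Omega>'[OF m] unfolding dyadic_cubes_def by blast }
    fix y z :: 'a assume "dist y z \<le> C3 * r powi k"
    from D5[OF this] obtain v0 v1 v2 where v: "v0 \<in> \<Omega>' k" "v1 \<in> \<Omega>' k" "v2 \<in> \<Omega>' k"
      "closure (Q' v0) \<inter> closure (Q' v1) \<noteq> {}" "closure (Q' v1) \<inter> closure (Q' v2) \<noteq> {}"
      "y \<in> closure (Q' v0)" "z \<in> closure (Q' v2)"
      by blast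
    have "\<exists>\<omega>\<in>\<Omega> k. Q' v = Q \<omega>" if "v \<in> \<Omega>' k" for v
      using that Q unfolding \<Omega>'_def by blast
    from this[OF v(1)] this[OF v(2)] this[OF v(3)]
    show "\<exists>\<omega>0\<in>\<Omega> k. \<exists>\<omega>1\<in>\<Omega> k. \<exists>\<omega>2\<in>\<Omega> k.
           closure (Q \<omega>0) \<inter> closure (Q \<omega>1) \<noteq> {} \<and> closure (Q \<omega>1) \<inter> closure (Q \<omega>2) \<noteq> {} \<and>
           y \<in> closure (Q \<omega>0) \<and> z \<in> closure (Q \<omega>2)"
      using v(4-7) by metis
  qed
  then show "\<exists>Q. dyadic_cubes C1 C2 C3 r \<Omega> x Q" by blast
qed

theorem theorem1p3:
  fixes c C :: real
  assumes "doubling_space TYPE('a::complete_space)"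
    and "uniformly_perfect_space TYPE('a)"
    and "0 < c" and "c < C"
  shows "(\<exists>C1>0. \<exists>C2>0. \<exists>C3>0. \<exists>r0>0.
            dyadic_constants TYPE(int \<times> 'a) TYPE('a) c C C1 C2 C3 r0) \<and>
         (\<forall>C1 C2 C3 r0.
            dyadic_constants TYPE(int \<times> 'a) TYPE('a) c C C1 C2 C3 r0 \<longrightarrow>
            dyadic_constants TYPE('i) TYPE('a) c C C1 C2 C3 r0)"
  using dyadic_constants_exist[OF assms] dyadic_constants_reindex[OF assms(3)] by blast

end
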